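(* Let $S$ be a simplicial sphere and let $d\ge 0$ be an integer. The wreath product $\partial\Delta_d\wr S$ is a polytopal sphere if and only if $S$ is a polytopal sphere.
   Context: Simplicial complexes are finite abstract simplicial complexes. A simplicial sphere is a simplicial complex whose geometric realization is homeomorphic to a sphere. A simplicial sphere is polytopal if it is isomorphic, as a simplicial complex, to the boundary complex of a simplicial convex polytope. Wreath product: let $K$ be a simplicial complex with vertices $v_1,\dots,v_n$ and let $\Delta_d$ be an abstract $d$-simplex ($d+1$ vertices). The simplicial complex $\partial\Delta_d\wr K$ has as vertices $d+1$ copies $v_k^1,\dots,v_k^{d+1}$ of each vertex $v_k$ of $K$ ($1\le k\le n$). Its facets are exactly the sets obtained as follows: choose a facet $F$ of $K$; take all $d+1$ copies of every vertex $v\in F$, and for every vertex $v\notin F$ take all copies of $v$ except exactly one (arbitrarily chosen) copy. *)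

theory Defs
  imports "HOL-Analysis.Analysis" "HOL-Analysis.Finite_Function_Topology"
begin

text \<open>Finite abstract simplicial complexes are given by their set of faces, the empty face included.
  Every element of \<open>\<Union>K\<close> is a vertex of \<open>K\<close>, so there are no "ghost" vertices.\<close>

definition abstract_simplicial_complex :: "'a set set \<Rightarrow> bool" where
  "abstract_simplicial_complex K \<longleftrightarrow>
     K \<noteq> {} \<and> finite (\<Union>K) \<and> (\<forall>\<sigma>\<in>K. \<forall>\<tau>. \<tau> \<subseteq> \<sigma> \<longrightarrow> \<tau> \<in> K)"

definition vertices :: "'a set set \<Rightarrow> 'a set" where
  "vertices K = \<Union>K"

definition facets :: "'a set set \<Rightarrow> 'a set set" where
  "facets K = {F \<in> K. \<forall>G\<in>K. F \<subseteq> G \<longrightarrow> F = G}"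

definition simplicial_iso :: "'a set set \<Rightarrow> 'b set set \<Rightarrow> bool" where
  "simplicial_iso K L \<longleftrightarrow>
     (\<exists>f. bij_betw f (vertices K) (vertices L) \<and>
          (\<forall>\<sigma>. \<sigma> \<subseteq> vertices K \<longrightarrow> (\<sigma> \<in> K \<longleftrightarrow> f ` \<sigma> \<in> L)))"

text \<open>The geometric realization in barycentric coordinates. All points vanish outside the finite
  set \<open>vertices K\<close>, so the product topology is the Euclidean one.\<close>

definition geometric_realization :: "'a set set \<Rightarrow> ('a \<Rightarrow> real) topology" where
  "geometric_realization K = subtopology (powertop_real UNIV)
     {x. {v. x v \<noteq> 0} \<in> K \<and> (\<forall>v. 0 \<le> x v) \<and> (\<Sum>v | x v \<noteq> 0. x v) = 1}"

text \<open>\<^term>\<open>nsphere n\<close> is the unit sphere in \<open>(n+1)\<close>-space. The first disjunct is the sphere of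
  dimension \<open>-1\<close>, i.e. the complex \<^term>\<open>{{}}\<close>, whose realization is empty.\<close>

definition simplicial_sphere :: "'a set set \<Rightarrow> bool" where
  "simplicial_sphere K \<longleftrightarrow> abstract_simplicial_complex K \<and>
     (K = {{}} \<or> (\<exists>n. geometric_realization K homeomorphic_space nsphere n))"

definition simplicial_polytope :: "'b::real_vector set \<Rightarrow> bool" where
  "simplicial_polytope P \<longleftrightarrow> polytope P \<and>
     (\<forall>F. F face_of P \<and> F \<noteq> P \<longrightarrow>
        (\<exists>C. finite C \<and> \<not> affine_dependent C \<and> F = convex hull C))"

text \<open>The vertex sets of the proper faces, where the empty face is proper.\<close>

definition boundary_complex :: "'b::real_vector set \<Rightarrow> 'b set set" where
  "boundary_complex P = {{v. v extreme_point_of F} | F. F face_of P \<and> F \<noteq> P}"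

text \<open>The dimension of the ambient space of the polytope is arbitrary. To quantify over it, we use
  that \<open>\<real>\<^sup>m\<close> is the subspace of \<^typ>\<open>nat \<Rightarrow>\<^sub>0 real\<close> of the vectors supported on \<open>{..<m}\<close>, and that
  every polytope in \<^typ>\<open>nat \<Rightarrow>\<^sub>0 real\<close>, being the convex hull of finitely many finitely supported
  vectors, lies in one of these subspaces.\<close>

definition polytopal_sphere :: "'a set set \<Rightarrow> bool" where
  "polytopal_sphere K \<longleftrightarrow> simplicial_sphere K \<and>
     (\<exists>P :: (nat \<Rightarrow>\<^sub>0 real) set. simplicial_polytope P \<and> simplicial_iso K (boundary_complex P))"

text \<open>The pairs \<open>(v, i)\<close> with \<open>i \<le> d\<close> are the \<open>d + 1\<close> copies of the vertex \<open>v\<close>, and \<open>c v\<close> is the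
  index of the copy of \<open>v\<close> that is left out.\<close>

definition wreath_facets :: "nat \<Rightarrow> 'a set set \<Rightarrow> ('a \<times> nat) set set" where
  "wreath_facets d K =
     {F \<times> {..d} \<union> {(v, i). v \<in> vertices K - F \<and> i \<le> d \<and> i \<noteq> c v} | F c.
        F \<in> facets K \<and> (\<forall>v \<in> vertices K - F. c v \<le> d)}"

definition wreath :: "nat \<Rightarrow> 'a set set \<Rightarrow> ('a \<times> nat) set set" where
  "wreath d K = {\<sigma>. \<exists>G \<in> wreath_facets d K. \<sigma> \<subseteq> G}"

lemma face_subset_facet:
  assumes "abstract_simplicial_complex K" "\<sigma> \<in> K"
  obtains F where "F \<in> facets K" "\<sigma> \<subseteq> F"
proof -
  have "finite K"
    using assms(1) by (auto simp: abstract_simplicial_complex_def intro: finite_UnionD)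
  then obtain F where "F \<in> K" "\<sigma> \<subseteq> F" "\<forall>G\<in>K. F \<subseteq> G \<longrightarrow> F = G"
    using finite_has_maximal2[OF _ assms(2)] by metis
  then show thesis
    using that by (auto simp: facets_def)
qed

lemma abstract_simplicial_complex_wreath:
  assumes "abstract_simplicial_complex K"
  shows "abstract_simplicial_complex (wreath d K)"
proof -
  obtain F where F: "F \<in> facets K"
    using assms face_subset_facet by (metis abstract_simplicial_complex_def equals0I)
  then have "F \<times> {..d} \<union> {(v, i). v \<in> vertices K - F \<and> i \<le> d \<and> i \<noteq> 0} \<in> wreath_facets d K"
    unfolding wreath_facets_def by (intro CollectI exI[of _ F] exI[of _ "\<lambda>_. 0"]) auto
  then have "wreath d K \<noteq> {}"
    by (auto simp: wreath_def)
  moreover have "\<Union>(wreath d K) \<subseteq> vertices K \<times> {..d}"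
    by (fastforce simp: wreath_def wreath_facets_def facets_def vertices_def)
  then have "finite (\<Union>(wreath d K))"
    using assms finite_subset
    by (fastforce simp: abstract_simplicial_complex_def vertices_def)
  ultimately show ?thesis
    unfolding abstract_simplicial_complex_def wreath_def by blast
qed

lemma wreath_facets_antichain:
  assumes "G \<in> wreath_facets d K" "H \<in> wreath_facets d K" "G \<subseteq> H"
  shows "G = H"
proof -
  obtain F c where F: "F \<in> facets K" "\<forall>v \<in> vertices K - F. c v \<le> d"
    and G: "G = F \<times> {..d} \<union> {(v, i). v \<in> vertices K - F \<and> i \<le> d \<and> i \<noteq> c v}"
    using assms(1) by (auto simp: wreath_facets_def)
  obtain F' c' where F': "F' \<in> facets K" "\<forall>v \<in> vertices K - F'. c' v \<le> d"
    and H: "H = F' \<times> {..d} \<union> {(v, i). v \<in> vertices K - F' \<and> i \<le> d \<and> i \<noteq> c' v}"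
    using assms(2) by (auto simp: wreath_facets_def)
  have "F \<subseteq> F'"
  proof
    fix v assume v: "v \<in> F"
    then have "v \<in> vertices K" using F(1) by (auto simp: facets_def vertices_def)
    show "v \<in> F'"
    proof (rule ccontr)
      assume "v \<notin> F'"
      then have "(v, c' v) \<in> G" "(v, c' v) \<notin> H"
        using v F'(2) \<open>v \<in> vertices K\<close> by (auto simp: G H)
      then show False using assms(3) by blast
    qed
  qed
  then have eq: "F = F'"
    using F(1) F'(1) by (auto simp: facets_def)
  have "c v = c' v" if "v \<in> vertices K - F" for v
  proof (rule ccontr)
    assume "c v \<noteq> c' v"
    then have "(v, c' v) \<in> G" "(v, c' v) \<notin> H"
      using that F'(2) by (auto simp: G H eq)
    then show False using assms(3) by blast
  qed
  then show ?thesis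
    by (auto simp: G H eq)
qed

lemma facets_wreath: "facets (wreath d K) = wreath_facets d K"
proof
  show "facets (wreath d K) \<subseteq> wreath_facets d K"
    by (force simp: facets_def wreath_def)
  show "wreath_facets d K \<subseteq> facets (wreath d K)"
  proof
    fix G assume G: "G \<in> wreath_facets d K"
    have "G = \<sigma>" if "\<sigma> \<in> wreath d K" "G \<subseteq> \<sigma>" for \<sigma>
      using that wreath_facets_antichain[OF G] unfolding wreath_def by blast
    then show "G \<in> facets (wreath d K)"
      using G by (auto simp: facets_def wreath_def)
  qed
qed

lemma vertices_wreath:
  assumes "abstract_simplicial_complex K"
  shows "vertices (wreath d K) = vertices K \<times> {..d}"
proof
  show "vertices (wreath d K) \<subseteq> vertices K \<times> {..d}"
    by (fastforce simp: wreath_def wreath_facets_def facets_def vertices_def)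
  show "vertices K \<times> {..d} \<subseteq> vertices (wreath d K)"
  proof (rule subrelI)
    fix v i assume "(v, i) \<in> vertices K \<times> {..d}"
    then have v: "v \<in> vertices K" and i: "i \<in> {..d}"
      by auto
    then obtain \<sigma> where "\<sigma> \<in> K" "v \<in> \<sigma>"
      by (auto simp: vertices_def)
    then obtain F where F: "F \<in> facets K" "v \<in> F"
      using face_subset_facet[OF assms] by blast
    let ?G = "F \<times> {..d} \<union> {(v, i). v \<in> vertices K - F \<and> i \<le> d \<and> i \<noteq> 0}"
    have "?G \<in> wreath_facets d K"
      unfolding wreath_facets_def using F(1)
      by (intro CollectI exI[of _ F] exI[of _ "\<lambda>_. 0"]) auto
    then have "?G \<in> wreath d K"
      by (auto simp: wreath_def)
    moreover have "(v, i) \<in> ?G"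
      using F(2) i by auto
    ultimately show "(v, i) \<in> vertices (wreath d K)"
      unfolding vertices_def by blast
  qed
qed

end

theory Submission
  imports Defs
begin

text \<open>The face lattice of the convex hull of points \<open>p v\<close> with \<open>v \<in> V\<close> is determined by the space
  \<open>\<Lambda>\<close> of their affine relations, and every subspace of \<open>\<real>\<^sup>V\<close> whose elements have coordinate sum 0
  arises as such a \<open>\<Lambda>\<close> (Gale duality). So polytopality of \<open>K\<close> is a condition on subspaces. If \<open>\<Lambda>\<close>
  realizes \<open>S\<close>, then giving the same coefficient to all copies of a vertex realizes the wreath product.
  Conversely \<open>S\<close> is the link of the face formed by the copies \<open>1, \<dots>, d\<close> of all vertices, and a link is
  realized by restricting relations and rescaling them. That a realized complex is a sphere follows
  by central projection from the barycentre of the vertices.\<close>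

subsection \<open>Faces of convex hulls and affine relations\<close>

text \<open>The wreath product adds points and raises the dimension of the polytope along with them,
  while the space of relations keeps its dimension. Seen through relations, both directions are
  therefore substitutions in coefficient vectors. The obstacle in the converse is that a given
  realization of the wreath product need not treat the copies of a vertex alike, so its relations
  need not be constant on copies. Keeping only one copy of each vertex avoids this, but destroys the
  zero sum. The repair must not disturb \<open>relation_face\<close>, which depends only on signs
  and zeros; positive weights respect both, and they exist because no nonzero restricted relation is
  nonnegative. Being a sphere is part of \<open>polytopal_sphere\<close>. For the wreath product
  this has to be proved, and the relations alone suffice for it. The complex \<open>{{}}\<close> is
  the boundary of a point but falls outside the criterion by relations, since there the whole vertex
  set is a face.\<close>

definition affine_relations :: "('a \<Rightarrow> 'b::real_vector) \<Rightarrow> 'a set \<Rightarrow> ('a \<Rightarrow> real) set" where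
  "affine_relations p V = {x. sum x V = 0 \<and> (\<Sum>v\<in>V. x v *\<^sub>R p v) = 0}"

text \<open>For the affine relations of points \<open>p v\<close> this says that the points with index in \<open>\<sigma>\<close> are
  exactly those lying on some face of the convex hull: the alternative to a supporting hyperplane
  in Farkas' lemma.\<close>

definition relation_face :: "('a \<Rightarrow> real) set \<Rightarrow> 'a set \<Rightarrow> 'a set \<Rightarrow> bool" where
  "relation_face \<Lambda> V \<sigma> \<longleftrightarrow>
     (\<forall>x\<in>\<Lambda>. (\<forall>v\<in>V - \<sigma>. 0 \<le> x v) \<longrightarrow> (\<forall>v\<in>V - \<sigma>. x v = 0))"

lemma convex_hull_image_finite:
  fixes p :: "'a \<Rightarrow> 'b::real_vector"
  assumes "finite V" "inj_on p V"
  shows "convex hull (p ` V) = {\<Sum>v\<in>V. a v *\<^sub>R p v | a. (\<forall>v\<in>V. 0 \<le> a v) \<and> sum a V = 1}"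
proof -
  have "(\<Sum>v\<in>V. a v *\<^sub>R p v) \<in> convex hull (p ` V)" if "\<forall>v\<in>V. 0 \<le> a v" "sum a V = 1" for a
    using that assms(1) by (intro convex_sum) (auto intro: hull_inc)
  moreover have "\<exists>a. y = (\<Sum>v\<in>V. a v *\<^sub>R p v) \<and> (\<forall>v\<in>V. 0 \<le> a v) \<and> sum a V = 1"
    if y: "y \<in> convex hull (p ` V)" for y
  proof -
    obtain u where "\<forall>x\<in>p ` V. 0 \<le> u x" "sum u (p ` V) = 1" "(\<Sum>x\<in>p ` V. u x *\<^sub>R x) = y"
      using y assms(1) by (auto simp: convex_hull_finite)
    then show ?thesis
      using assms(2) by (intro exI[of _ "u \<circ> p"]) (auto simp: sum.reindex)
  qed
  ultimately show ?thesis by fast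
qed

lemma sum_two_parts:
  fixes f :: "'a \<Rightarrow> 'b::comm_monoid_add"
  assumes "finite V"
  shows "sum f V = (\<Sum>v | v \<in> V \<and> Q v. f v) + (\<Sum>v | v \<in> V \<and> \<not> Q v. f v)"
proof -
  have "V = {v \<in> V. Q v} \<union> {v \<in> V. \<not> Q v}" by auto
  then show ?thesis
    using assms sum.union_disjoint[of "{v \<in> V. Q v}" "{v \<in> V. \<not> Q v}" f] by fastforce
qed

text \<open>Splitting off \<open>v\<close> writes the point as a mixture of \<open>p v\<close> and
  the normalised rest \<open>y\<close>, which lies in \<open>C\<close>; a face containing an inner
  point of a segment contains its ends. The degenerate cases are that all weight sits on
  \<open>v\<close> and that \<open>y\<close> equals \<open>p v\<close>.\<close>

lemma face_of_convex_sum: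
  fixes p :: "'a \<Rightarrow> 'b::real_vector"
  assumes F: "F face_of C" "convex C" and V: "finite V" "\<And>u. u \<in> V \<Longrightarrow> p u \<in> C"
    and a: "\<And>u. u \<in> V \<Longrightarrow> 0 \<le> a u" "sum a V = 1" "(\<Sum>u\<in>V. a u *\<^sub>R p u) \<in> F"
    and v: "v \<in> V" "0 < a v"
  shows "p v \<in> F"
proof -
  have split: "sum a V = a v + sum a (V - {v})"
    "(\<Sum>u\<in>V. a u *\<^sub>R p u) = a v *\<^sub>R p v + (\<Sum>u\<in>V - {v}. a u *\<^sub>R p u)"
    using V(1) v(1) by (simp_all add: sum.remove)
  show ?thesis
  proof (cases "a v = 1")
    case True
    then have "\<forall>u\<in>V - {v}. a u = 0"
      using split(1) a V(1) sum_nonneg_eq_0_iff[of "V - {v}" a] by auto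
    then show ?thesis using split(2) a(3) True by simp
  next
    case False
    define s where "s = sum a (V - {v})"
    have s: "s = 1 - a v" using split(1) a(2) by (simp add: s_def)
    have "0 \<le> s" unfolding s_def using a(1) by (intro sum_nonneg) auto
    then have s0: "0 < s" using s False by simp
    define y where "y = (\<Sum>u\<in>V - {v}. (a u / s) *\<^sub>R p u)"
    have y: "y \<in> C" unfolding y_def
      using V a(1) s0 F(2) by (intro convex_sum) (auto simp: s_def sum_divide_distrib[symmetric])
    have x: "(\<Sum>u\<in>V. a u *\<^sub>R p u) = (1 - s) *\<^sub>R p v + s *\<^sub>R y"
      using s0 s by (simp add: split(2) y_def scaleR_sum_right)
    show ?thesis
    proof (cases "p v = y")
      case True
      then show ?thesis using x a(3) by (simp add: scaleR_left_diff_distrib)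
    next
      case False
      then have "(\<Sum>u\<in>V. a u *\<^sub>R p u) \<in> open_segment (p v) y"
        using x s0 s v unfolding in_segment by (intro conjI exI[of _ s]) auto
      then show ?thesis
        using F(1) y V(2)[OF v(1)] a(3) unfolding face_of_def by blast
    qed
  qed
qed

lemma face_of_convex_hull_image:
  fixes p :: "'a \<Rightarrow> 'b::real_vector"
  assumes V: "finite V" "inj_on p V" and F: "F face_of convex hull (p ` V)"
  shows "F = convex hull (p ` {v \<in> V. p v \<in> F})"
    and "relation_face (affine_relations p V) V {v \<in> V. p v \<in> F}"
proof -
  let ?\<sigma> = "{v \<in> V. p v \<in> F}"
  have inC: "\<And>u. u \<in> V \<Longrightarrow> p u \<in> convex hull (p ` V)" by (simp add: hull_inc)
  have cF: "convex F" using F by (rule face_of_imp_convex)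
  have inF: "p v \<in> F" if "\<And>u. u \<in> V \<Longrightarrow> 0 \<le> a u" "sum a V = 1" "(\<Sum>u\<in>V. a u *\<^sub>R p u) \<in> F"
    "v \<in> V" "0 < a v" for a v
    by (rule face_of_convex_sum[OF F convex_convex_hull V(1) inC]) (use that in auto)
  show "F = convex hull (p ` ?\<sigma>)"
  proof
    show "convex hull (p ` ?\<sigma>) \<subseteq> F"
      using cF by (intro hull_minimal) auto
    show "F \<subseteq> convex hull (p ` ?\<sigma>)"
    proof
      fix x assume x: "x \<in> F"
      then have "x \<in> convex hull (p ` V)" using F face_of_imp_subset by blast
      then obtain a where a: "\<forall>v\<in>V. 0 \<le> a v" "sum a V = 1" "x = (\<Sum>v\<in>V. a v *\<^sub>R p v)"
        using V by (auto simp: convex_hull_image_finite)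
      have 0: "a v = 0" if "v \<in> V - ?\<sigma>" for v
        using inF[of a v] that a x by force
      have "sum a ?\<sigma> = 1" "x = (\<Sum>v\<in>?\<sigma>. a v *\<^sub>R p v)"
        unfolding a(2)[symmetric] a(3)
        using V(1) 0 by (intro sum.mono_neutral_left sum.mono_neutral_right; auto)+
      then show "x \<in> convex hull (p ` ?\<sigma>)"
        using V(1) a(1) by (simp only:) (intro convex_sum; auto intro: hull_inc)
    qed
  qed
  show "relation_face (affine_relations p V) V ?\<sigma>"
    unfolding relation_face_def
  proof (intro ballI impI)
    fix x v
    assume x: "x \<in> affine_relations p V" and pos: "\<forall>v\<in>V - ?\<sigma>. 0 \<le> x v" and v: "v \<in> V - ?\<sigma>"
    show "x v = 0"
    proof (rule ccontr)
      assume "x v \<noteq> 0"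
      then have xv: "0 < x v" using pos v by force
      \<comment> \<open>Moving the nonpositive terms to the other side gives two expressions of one
        point \<open>y\<close>, from \<open>P\<close> and from \<open>N\<close>. Off
        \<open>?\<sigma>\<close> the indices in \<open>N\<close> carry coefficient 0, so
        \<open>y\<close> lies in \<open>F\<close>, and extremality then pulls \<open>p v\<close>
        into \<open>F\<close>.\<close>
      define P where "P = {u \<in> V. 0 < x u}"
      define N where "N = {u \<in> V. \<not> 0 < x u}"
      have fin: "finite P" "finite N" using V(1) by (auto simp: P_def N_def)
      have N0: "x u = 0" if "u \<in> N - ?\<sigma>" for u
        using pos that unfolding N_def by force
      define s where "s = sum x P"
      have s0: "0 < s" unfolding s_def
        using v xv fin by (intro sum_pos) (auto simp: P_def)
      have sN: "sum x N = - s" and pN: "(\<Sum>u\<in>N. x u *\<^sub>R p u) = - (\<Sum>u\<in>P. x u *\<^sub>R p u)"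
        using x sum_two_parts[OF V(1), of x "\<lambda>u. 0 < x u"]
          sum_two_parts[OF V(1), of "\<lambda>u. x u *\<^sub>R p u" "\<lambda>u. 0 < x u"]
        unfolding affine_relations_def P_def[symmetric] N_def[symmetric] s_def
        by (auto simp: add_eq_0_iff minus_equation_iff)
      define y where "y = (\<Sum>u\<in>P. (x u / s) *\<^sub>R p u)"
      have "y = (1 / s) *\<^sub>R (\<Sum>u\<in>P. x u *\<^sub>R p u)"
        by (simp add: y_def scaleR_sum_right)
      also have "(\<Sum>u\<in>P. x u *\<^sub>R p u) = - (\<Sum>u\<in>N. x u *\<^sub>R p u)"
        using pN by simp
      also have "(1 / s) *\<^sub>R (- (\<Sum>u\<in>N. x u *\<^sub>R p u)) = (\<Sum>u\<in>N \<inter> ?\<sigma>. (- x u / s) *\<^sub>R p u)"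
      proof -
        have "(1 / s) *\<^sub>R (- (\<Sum>u\<in>N. x u *\<^sub>R p u)) = (\<Sum>u\<in>N. (- x u / s) *\<^sub>R p u)"
          by (simp add: scaleR_sum_right sum_negf[symmetric])
        also have "\<dots> = (\<Sum>u\<in>N \<inter> ?\<sigma>. (- x u / s) *\<^sub>R p u)"
          using fin N0 by (intro sum.mono_neutral_right) auto
        finally show ?thesis .
      qed
      also have "\<dots> \<in> F"
      proof (intro convex_sum cF)
        have "sum x (N \<inter> ?\<sigma>) = sum x N"
          using fin N0 by (intro sum.mono_neutral_left) auto
        then show "(\<Sum>u\<in>N \<inter> ?\<sigma>. - x u / s) = 1"
          using sN s0 by (simp add: sum_divide_distrib[symmetric] sum_negf)
      qed (use fin s0 in \<open>auto simp: N_def field_simps\<close>)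
      finally have yF: "y \<in> F" .
      have "p v \<in> F"
      proof (rule face_of_convex_sum[OF F convex_convex_hull fin(1)])
        show "(\<Sum>u\<in>P. (x u / s) *\<^sub>R p u) \<in> F" using yF by (simp add: y_def)
        show "(\<Sum>u\<in>P. x u / s) = 1" using s0 by (simp add: s_def sum_divide_distrib[symmetric])
        show "v \<in> P" "0 < x v / s" using v xv s0 by (auto simp: P_def)
      qed (use inC s0 in \<open>auto simp: P_def\<close>)
      then show False using v by blast
    qed
  qed
qed

text \<open>Two convex representations of one point differ by an affine relation. The second one is
  supported on \<open>\<sigma>\<close>, so off \<open>\<sigma>\<close> the difference is just
  \<open>a\<close>, hence nonnegative.\<close>

lemma relation_face_convex_combination:
  fixes p :: "'a \<Rightarrow> 'b::real_vector"
  assumes V: "finite V" "inj_on p V" "\<sigma> \<subseteq> V"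
    and rel: "relation_face (affine_relations p V) V \<sigma>"
    and a: "\<forall>v\<in>V. 0 \<le> a v" "sum a V = 1" "(\<Sum>v\<in>V. a v *\<^sub>R p v) \<in> convex hull (p ` \<sigma>)"
  shows "\<forall>v\<in>V - \<sigma>. a v = 0"
proof -
  have fs: "finite \<sigma>" "inj_on p \<sigma>" using V finite_subset inj_on_subset by blast+
  obtain b where b: "\<forall>v\<in>\<sigma>. 0 \<le> b v" "sum b \<sigma> = 1"
    "(\<Sum>v\<in>V. a v *\<^sub>R p v) = (\<Sum>v\<in>\<sigma>. b v *\<^sub>R p v)"
    using a(3) by (auto simp: convex_hull_image_finite fs)
  define x where "x v = a v - (if v \<in> \<sigma> then b v else 0)" for v
  have "(\<Sum>v\<in>V. if v \<in> \<sigma> then b v else 0) = sum b \<sigma>"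
    "(\<Sum>v\<in>V. (if v \<in> \<sigma> then b v else 0) *\<^sub>R p v) = (\<Sum>v\<in>\<sigma>. b v *\<^sub>R p v)"
    using V by (intro sum.mono_neutral_cong_right; auto)+
  then have "x \<in> affine_relations p V"
    using a b by (simp add: affine_relations_def x_def sum_subtractf scaleR_left_diff_distrib)
  moreover have "\<forall>v\<in>V - \<sigma>. 0 \<le> x v" using a by (simp add: x_def)
  ultimately have "\<forall>v\<in>V - \<sigma>. x v = 0" using rel unfolding relation_face_def by blast
  then show ?thesis by (simp add: x_def)
qed

text \<open>If an inner point of a segment lies in the hull belonging to \<open>\<sigma>\<close>,
  the mixed coefficients vanish off \<open>\<sigma>\<close>; being sums of nonnegative terms, they
  force both ends to be supported on \<open>\<sigma>\<close>. The second claim rules out stray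
  labels, so \<open>\<sigma>\<close> can be recovered from the face.\<close>

lemma relation_face_imp_face_of:
  fixes p :: "'a \<Rightarrow> 'b::real_vector"
  assumes V: "finite V" "inj_on p V" "\<sigma> \<subseteq> V"
    and rel: "relation_face (affine_relations p V) V \<sigma>"
  shows "convex hull (p ` \<sigma>) face_of convex hull (p ` V)"
    and "{v \<in> V. p v \<in> convex hull (p ` \<sigma>)} = \<sigma>"
proof -
  note zero = relation_face_convex_combination[OF V rel]
  have fs: "finite \<sigma>" using V finite_subset by blast
  have conc: "(\<Sum>v\<in>V. a v *\<^sub>R p v) \<in> convex hull (p ` \<sigma>)"
    if a: "\<forall>v\<in>V. 0 \<le> a v" "sum a V = 1" and 0: "\<forall>v\<in>V - \<sigma>. a v = 0" for a
  proof -
    have "sum a \<sigma> = 1" "(\<Sum>v\<in>V. a v *\<^sub>R p v) = (\<Sum>v\<in>\<sigma>. a v *\<^sub>R p v)"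
      unfolding a(2)[symmetric]
      using V 0 by (intro sum.mono_neutral_left sum.mono_neutral_right; auto)+
    with fs a(1) V(3) show ?thesis
      by (simp only:) (intro convex_sum; auto intro: hull_inc)
  qed
  show "convex hull (p ` \<sigma>) face_of convex hull (p ` V)"
    unfolding face_of_def
  proof (intro conjI ballI impI)
    show "convex hull (p ` \<sigma>) \<subseteq> convex hull (p ` V)" using V(3) by (intro hull_mono) auto
    show "convex (convex hull (p ` \<sigma>))" by simp
    fix y z x
    assume y: "y \<in> convex hull (p ` V)" and z: "z \<in> convex hull (p ` V)"
      and x: "x \<in> convex hull (p ` \<sigma>)" and seg: "x \<in> open_segment y z"
    obtain a where a: "\<forall>v\<in>V. 0 \<le> a v" "sum a V = 1" "y = (\<Sum>v\<in>V. a v *\<^sub>R p v)"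
      using y by (auto simp: convex_hull_image_finite V)
    obtain b where b: "\<forall>v\<in>V. 0 \<le> b v" "sum b V = 1" "z = (\<Sum>v\<in>V. b v *\<^sub>R p v)"
      using z by (auto simp: convex_hull_image_finite V)
    obtain t where t: "0 < t" "t < 1" "x = (1 - t) *\<^sub>R y + t *\<^sub>R z"
      using seg by (auto simp: in_segment)
    define c where "c v = (1 - t) * a v + t * b v" for v
    have "\<forall>v\<in>V. 0 \<le> c v" using a b t by (simp add: c_def)
    moreover have "sum c V = 1"
      using a(2) b(2) by (simp add: c_def sum.distrib sum_distrib_left[symmetric])
    moreover have "(\<Sum>v\<in>V. c v *\<^sub>R p v) = x"
      by (simp add: t(3) a(3) b(3) c_def scaleR_sum_right sum.distrib scaleR_left_distrib)
    ultimately have "\<forall>v\<in>V - \<sigma>. c v = 0" using zero x by blast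
    then have "\<forall>v\<in>V - \<sigma>. a v = 0 \<and> b v = 0"
      using a(1) b(1) t by (auto simp: c_def add_nonneg_eq_0_iff)
    then show "y \<in> convex hull (p ` \<sigma>)" "z \<in> convex hull (p ` \<sigma>)"
      using conc a b by blast+
  qed
  show "{v \<in> V. p v \<in> convex hull (p ` \<sigma>)} = \<sigma>"
  proof (intro subset_antisym subsetI)
    fix v assume "v \<in> {v \<in> V. p v \<in> convex hull (p ` \<sigma>)}"
    then have v: "v \<in> V" "p v \<in> convex hull (p ` \<sigma>)" by auto
    have "(\<Sum>u\<in>V. (if u = v then 1 else 0) *\<^sub>R p u) = p v"
      using V(1) v(1) by (simp add: if_distrib[of "\<lambda>c. c *\<^sub>R _"] cong: if_cong)
    then have "\<forall>u\<in>V - \<sigma>. (if u = v then 1 else 0) = (0::real)"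
      by (intro zero) (use v V(1) in auto)
    then show "v \<in> \<sigma>" using v(1) by (metis DiffI zero_neq_one)
  qed (use V(3) in \<open>auto intro: hull_inc\<close>)
qed

text \<open>A generating set of least cardinality has no redundant point, and a point outside the
  hull of the others is extreme. The argument is purely algebraic, so it holds without any topology
  on the space.\<close>

lemma polytope_eq_convex_hull_extreme_points:
  fixes P :: "'b::real_vector set"
  assumes "polytope P"
  shows "finite {x. x extreme_point_of P}" "P = convex hull {x. x extreme_point_of P}"
proof -
  obtain C0 where "finite C0 \<and> convex hull C0 = P"
    using assms unfolding polytope_def by auto
  from ex_has_least_nat[of "\<lambda>C. finite C \<and> convex hull C = P", OF this, of card]
  obtain C where C: "finite C" "convex hull C = P"
    "\<And>D. finite D \<and> convex hull D = P \<Longrightarrow> card C \<le> card D"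
    by blast
  have "c extreme_point_of P" if c: "c \<in> C" for c
  proof -
    have nin: "c \<notin> convex hull (C - {c})"
    proof
      assume "c \<in> convex hull (C - {c})"
      then have "convex hull (C - {c}) = P"
        using hull_redundant[of c convex "C - {c}"] C(2) c by (simp add: insert_absorb)
      then have "card C \<le> card (C - {c})" using C by blast
      then show False using card_Diff1_less[OF C(1) c] by simp
    qed
    show ?thesis
      using extreme_point_of_convex_hull_insert[OF _ nin] C c by (simp add: insert_absorb)
  qed
  then have "{x. x extreme_point_of P} = C"
    using C(2) extreme_point_of_convex_hull by blast
  then show "finite {x. x extreme_point_of P}" "P = convex hull {x. x extreme_point_of P}"
    using C by auto
qed

subsection \<open>Linear inequalities and equations on function spaces\<close>

text \<open>A linear subspace, with sums and multiples in one closure condition. Values outside the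
  vertex set are unconstrained, which is why later statements compare functions only on
  \<open>V\<close>.\<close>

definition function_subspace :: "('a \<Rightarrow> real) set \<Rightarrow> bool" where
  "function_subspace \<Lambda> \<longleftrightarrow>
     (\<lambda>_. 0) \<in> \<Lambda> \<and> (\<forall>x\<in>\<Lambda>. \<forall>y\<in>\<Lambda>. \<forall>c. (\<lambda>v. x v + c * y v) \<in> \<Lambda>)"

lemma function_subspace_0: "function_subspace \<Lambda> \<Longrightarrow> (\<lambda>_. 0) \<in> \<Lambda>"
  and function_subspace_comb:
    "function_subspace \<Lambda> \<Longrightarrow> x \<in> \<Lambda> \<Longrightarrow> y \<in> \<Lambda> \<Longrightarrow> (\<lambda>v. x v + c * y v) \<in> \<Lambda>"
  by (auto simp: function_subspace_def)

lemma function_subspace_scale: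
  assumes "function_subspace \<Lambda>" "x \<in> \<Lambda>"
  shows "(\<lambda>v. c * x v) \<in> \<Lambda>"
  using function_subspace_comb[OF assms(1) function_subspace_0[OF assms(1)] assms(2)] by simp

lemma function_subspace_vanishing:
  "function_subspace \<Lambda> \<Longrightarrow> function_subspace {x \<in> \<Lambda>. x a = 0}"
  by (simp add: function_subspace_def)

lemma function_subspace_affine_relations: "function_subspace (affine_relations p V)"
  by (simp add: function_subspace_def affine_relations_def sum.distrib scaleR_add_left
      sum_distrib_left[symmetric] scaleR_sum_right[symmetric] flip: scaleR_scaleR)

text \<open>Induction eliminates one inequality at a time. If the one at \<open>u\<close> cannot be
  dropped, some element violates only it; scaled to value -1 at \<open>u\<close>, it serves to
  project \<open>\<Lambda>\<close> onto the subspace of elements vanishing at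
  \<open>u\<close>.\<close>

lemma farkas:
  assumes "finite U" "function_subspace \<Lambda>"
    and "\<And>x. x \<in> \<Lambda> \<Longrightarrow> \<forall>u\<in>U. 0 \<le> x u \<Longrightarrow> x a \<le> 0"
  shows "\<exists>w. (\<forall>u\<in>U. 0 \<le> w u) \<and> (\<forall>x\<in>\<Lambda>. x a + (\<Sum>u\<in>U. w u * x u) = (0::real))"
  using assms
proof (induction U arbitrary: \<Lambda> rule: finite_induct)
  case empty
  have "x a = 0" if "x \<in> \<Lambda>" for x
    using empty(2)[OF that] empty(2)[OF function_subspace_scale[OF empty(1) that, of "-1"]] by simp
  then show ?case by simp
next
  case (insert u U \<Lambda>)
  show ?case
  proof (cases "\<forall>x\<in>\<Lambda>. (\<forall>u\<in>U. 0 \<le> x u) \<longrightarrow> x a \<le> 0")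
    case True
    with insert.IH[OF insert.prems(1)] obtain w
      where w: "\<forall>u\<in>U. 0 \<le> w u" "\<forall>x\<in>\<Lambda>. x a + (\<Sum>u\<in>U. w u * x u) = 0"
      by blast
    have "(\<Sum>v\<in>U. (w(u := 0)) v * x v) = (\<Sum>v\<in>U. w v * x v)" for x
      using insert.hyps by (intro sum.cong) auto
    then show ?thesis
      using w insert.hyps by (intro exI[of _ "w(u := 0)"]) auto
  next
    case False
    then obtain x1 where x1: "x1 \<in> \<Lambda>" "\<forall>u\<in>U. 0 \<le> x1 u" "0 < x1 a" by force
    then have neg: "x1 u < 0"
      using insert.prems(2)[OF x1(1)] by force
    define x0 where "x0 = (\<lambda>v. (- 1 / x1 u) * x1 v)"
    have x0: "x0 \<in> \<Lambda>" "\<forall>u\<in>U. 0 \<le> x0 u" "0 < x0 a" "x0 u = - 1"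
      unfolding x0_def using function_subspace_scale[OF insert.prems(1) x1(1), of "- 1 / x1 u"] x1 neg
      by (simp_all add: divide_nonneg_neg divide_pos_neg)
    let ?L = "{x \<in> \<Lambda>. x u = 0}"
    have "\<exists>w. (\<forall>u\<in>U. 0 \<le> w u) \<and> (\<forall>x\<in>?L. x a + (\<Sum>u\<in>U. w u * x u) = 0)"
      using insert.prems by (intro insert.IH function_subspace_vanishing) auto
    then obtain w where w: "\<forall>u\<in>U. 0 \<le> w u" "\<forall>x\<in>?L. x a + (\<Sum>u\<in>U. w u * x u) = 0"
      by blast
    \<comment> \<open>The weight of \<open>u\<close> is the value at \<open>x0\<close> of the
      functional found on \<open>?L\<close>: adding \<open>x u\<close> times \<open>x0\<close> moves
      any \<open>x\<close> into \<open>?L\<close>, and exactly this term is left over.\<close>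
    define r where "r = x0 a + (\<Sum>v\<in>U. w v * x0 v)"
    have "0 \<le> (\<Sum>v\<in>U. w v * x0 v)" using w x0 by (intro sum_nonneg) auto
    then have r: "0 \<le> r" using x0(3) by (simp add: r_def)
    have eq: "x a + (\<Sum>v\<in>U. w v * x v) + r * x u = 0" if x: "x \<in> \<Lambda>" for x
    proof -
      have "(\<lambda>v. x v + x u * x0 v) \<in> ?L"
        using function_subspace_comb[OF insert.prems(1) x x0(1)] x0(4) by simp
      then have "x a + x u * x0 a + (\<Sum>v\<in>U. w v * (x v + x u * x0 v)) = 0"
        using w(2) by fastforce
      then show ?thesis
        by (simp add: r_def algebra_simps sum.distrib sum_distrib_left)
    qed
    have "(\<Sum>v\<in>U. (w(u := r)) v * x v) = (\<Sum>v\<in>U. w v * x v)" for x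
      using insert.hyps by (intro sum.cong) auto
    then show ?thesis
      using w(1) eq r insert.hyps by (intro exI[of _ "w(u := r)"]) (auto simp: algebra_simps)
  qed
qed

text \<open>\<open>farkas\<close> with target \<open>a\<close> gives nonnegative weights that are 1
  at \<open>a\<close>; adding them up over all \<open>a\<close> makes every weight positive.\<close>

lemma stiemke:
  assumes V: "finite V" and \<Lambda>: "function_subspace \<Lambda>"
    and nonneg: "\<And>x. x \<in> \<Lambda> \<Longrightarrow> \<forall>v\<in>V. 0 \<le> x v \<Longrightarrow> \<forall>v\<in>V. x v = 0"
  shows "\<exists>w. (\<forall>v\<in>V. 0 < w v) \<and> (\<forall>x\<in>\<Lambda>. (\<Sum>v\<in>V. w v * x v) = (0::real))"
proof -
  have "\<exists>w. (\<forall>v\<in>V. 0 \<le> w v) \<and> 0 < w a \<and> (\<forall>x\<in>\<Lambda>. (\<Sum>v\<in>V. w v * x v) = 0)"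
    if a: "a \<in> V" for a
  proof -
    have "x a \<le> 0" if "x \<in> \<Lambda>" "\<forall>u\<in>V - {a}. 0 \<le> x u" for x
      using nonneg[OF that(1)] that(2) a by force
    then obtain w where w: "\<forall>u\<in>V - {a}. 0 \<le> w u"
      "\<forall>x\<in>\<Lambda>. x a + (\<Sum>u\<in>V - {a}. w u * x u) = 0"
      using farkas[of "V - {a}" \<Lambda> a] V \<Lambda> by auto
    have "(\<Sum>v\<in>V. (w(a := 1)) v * x v) = x a + (\<Sum>u\<in>V - {a}. w u * x u)" for x
      using V a by (simp add: sum.remove[of V a])
    then show ?thesis using w by (intro exI[of _ "w(a := 1)"]) auto
  qed
  then obtain W where W: "\<And>a. a \<in> V \<Longrightarrow> \<forall>v\<in>V. 0 \<le> W a v" "\<And>a. a \<in> V \<Longrightarrow> 0 < W a a"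
    "\<And>a. a \<in> V \<Longrightarrow> \<forall>x\<in>\<Lambda>. (\<Sum>v\<in>V. W a v * x v) = 0"
    by metis
  show ?thesis
  proof (intro exI[of _ "\<lambda>v. \<Sum>a\<in>V. W a v"] conjI ballI)
    show "0 < (\<Sum>a\<in>V. W a v)" if "v \<in> V" for v
      using V W that by (intro sum_pos2[of V v]) auto
    show "(\<Sum>v\<in>V. (\<Sum>a\<in>V. W a v) * x v) = 0" if "x \<in> \<Lambda>" for x
      using W(3) that by (simp add: sum_distrib_right sum.swap[of _ V V])
  qed
qed

text \<open>The rows \<open>b j\<close> form a basis of the orthogonal complement of
  \<open>\<Lambda>\<close> restricted to \<open>V\<close>. The second clause is their linear
  independence, which later makes the projection reach every direction. The induction is elimination
  of one coordinate at a time.\<close>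

lemma function_subspace_equations:
  assumes "finite V" "function_subspace \<Lambda>"
  obtains m and b :: "nat \<Rightarrow> 'a \<Rightarrow> real"
  where "\<And>x. (\<exists>y\<in>\<Lambda>. \<forall>v\<in>V. y v = x v) \<longleftrightarrow> (\<forall>j<m. (\<Sum>v\<in>V. b j v * x v) = 0)"
    and "\<And>u. \<exists>z. \<forall>j<m. (\<Sum>v\<in>V. b j v * z v) = u j"
proof -
  have "\<exists>m (b :: nat \<Rightarrow> 'a \<Rightarrow> real).
      (\<forall>x. (\<exists>y\<in>\<Lambda>. \<forall>v\<in>V. y v = x v) \<longleftrightarrow> (\<forall>j<m. (\<Sum>v\<in>V. b j v * x v) = 0)) \<and>
      (\<forall>u. \<exists>z. \<forall>j<m. (\<Sum>v\<in>V. b j v * z v) = u j)"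
    using assms
  proof (induction V arbitrary: \<Lambda> rule: finite_induct)
    case empty
    then show ?case by (intro exI[of _ 0]) (auto intro: function_subspace_0)
  next
    case (insert a V \<Lambda>)
    let ?L = "{x \<in> \<Lambda>. x a = 0}"
    obtain m and b :: "nat \<Rightarrow> 'a \<Rightarrow> real" where
      b: "\<And>x. (\<exists>y\<in>?L. \<forall>v\<in>V. y v = x v) \<longleftrightarrow> (\<forall>j<m. (\<Sum>v\<in>V. b j v * x v) = (0::real))"
      and surj: "\<And>u. \<exists>z. \<forall>j<m. (\<Sum>v\<in>V. b j v * z v) = u j"
      using insert.IH[OF function_subspace_vanishing[OF insert.prems, of a]] by blast
    have cong: "(\<Sum>v\<in>V. (g(a := t)) v * (z(a := s)) v) = (\<Sum>v\<in>V. g v * z v)"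
      "(\<Sum>v\<in>V. (g(a := t)) v * z v) = (\<Sum>v\<in>V. g v * z v)" for g z :: "'a \<Rightarrow> real" and s t
      using insert.hyps by (intro sum.cong; auto)+
    show ?case
    proof (cases "\<forall>x\<in>\<Lambda>. x a = 0")
      case True
      \<comment> \<open>Vanishing at \<open>a\<close> is a new equation; the old rows get
        coefficient 0 there, since the induction says nothing about \<open>b j a\<close>.\<close>
      define c where "c j = (if j = m then (\<lambda>_. 0)(a := 1) else (b j)(a := 0))" for j
      have c: "(\<Sum>v\<in>insert a V. c j v * x v) = (if j = m then x a else (\<Sum>v\<in>V. b j v * x v))" for j x
        using insert.hyps cong[where z = x] by (simp add: c_def del: fun_upd_apply) simp
      show ?thesis
      proof (intro exI[of _ "Suc m"] exI[of _ c] conjI allI)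
        fix x
        have "(\<exists>y\<in>\<Lambda>. \<forall>v\<in>insert a V. y v = x v) \<longleftrightarrow> x a = 0 \<and> (\<exists>y\<in>?L. \<forall>v\<in>V. y v = x v)"
          using True by force
        then show "(\<exists>y\<in>\<Lambda>. \<forall>v\<in>insert a V. y v = x v) \<longleftrightarrow>
            (\<forall>j<Suc m. (\<Sum>v\<in>insert a V. c j v * x v) = 0)"
          unfolding b c by (auto simp: less_Suc_eq)
      next
        fix u
        obtain z where z: "\<forall>j<m. (\<Sum>v\<in>V. b j v * z v) = u j" using surj by blast
        have "(\<Sum>v\<in>V. b j v * (z(a := u m)) v) = (\<Sum>v\<in>V. b j v * z v)" for j
          using insert.hyps by (intro sum.cong) auto
        then show "\<exists>z. \<forall>j<Suc m. (\<Sum>v\<in>insert a V. c j v * z v) = u j"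
          unfolding c using z by (intro exI[of _ "z(a := u m)"]) (auto simp: less_Suc_eq)
      qed
    next
      case False
      then obtain x1 where x1: "x1 \<in> \<Lambda>" "x1 a \<noteq> 0" by blast
      define x0 where "x0 = (\<lambda>v. (1 / x1 a) * x1 v)"
      have x0: "x0 \<in> \<Lambda>" "x0 a = 1"
        unfolding x0_def using function_subspace_scale[OF insert.prems x1(1), of "1 / x1 a"] x1(2)
        by auto
      \<comment> \<open>The entry at \<open>a\<close> makes each row vanish on \<open>x0\<close>. A
        row applied to \<open>x\<close> is then the old row applied to \<open>x\<close> minus
        \<open>x a\<close> times \<open>x0\<close>, which is 0 at \<open>a\<close>; no equation is
        added.\<close>
      define c where "c j = (b j)(a := - (\<Sum>v\<in>V. b j v * x0 v))" for j
      have c: "(\<Sum>v\<in>insert a V. c j v * x v) = (\<Sum>v\<in>V. b j v * (x v - x a * x0 v))" for j x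
      proof -
        have "(\<Sum>v\<in>insert a V. c j v * x v) =
            - (\<Sum>v\<in>V. b j v * x0 v) * x a + (\<Sum>v\<in>V. b j v * x v)"
          using insert.hyps cong(2)[of "b j" _ x] by (simp add: c_def del: fun_upd_apply) simp
        then show ?thesis
          by (simp add: algebra_simps sum_subtractf sum_distrib_left)
      qed
      show ?thesis
      proof (intro exI[of _ m] exI[of _ c] conjI allI)
        fix x
        have "(\<exists>y\<in>\<Lambda>. \<forall>v\<in>insert a V. y v = x v) \<longleftrightarrow>
            (\<exists>y\<in>?L. \<forall>v\<in>V. y v = x v - x a * x0 v)"
        proof
          assume "\<exists>y\<in>\<Lambda>. \<forall>v\<in>insert a V. y v = x v"
          then obtain y where y: "y \<in> \<Lambda>" "\<forall>v\<in>insert a V. y v = x v" by blast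
          then show "\<exists>y\<in>?L. \<forall>v\<in>V. y v = x v - x a * x0 v"
            using function_subspace_comb[OF insert.prems y(1) x0(1), of "- x a"] x0(2)
            by (intro bexI[of _ "\<lambda>v. y v + - x a * x0 v"]) auto
        next
          assume "\<exists>y\<in>?L. \<forall>v\<in>V. y v = x v - x a * x0 v"
          then obtain y where y: "y \<in> ?L" "\<forall>v\<in>V. y v = x v - x a * x0 v" by blast
          then show "\<exists>y\<in>\<Lambda>. \<forall>v\<in>insert a V. y v = x v"
            using function_subspace_comb[OF insert.prems _ x0(1), of y "x a"] x0(2)
            by (intro bexI[of _ "\<lambda>v. y v + x a * x0 v"]) auto
        qed
        then show "(\<exists>y\<in>\<Lambda>. \<forall>v\<in>insert a V. y v = x v) \<longleftrightarrow>
            (\<forall>j<m. (\<Sum>v\<in>insert a V. c j v * x v) = 0)"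
          unfolding c b .
      next
        fix u
        obtain z where z: "\<forall>j<m. (\<Sum>v\<in>V. b j v * z v) = u j" using surj by blast
        have "(\<Sum>v\<in>V. b j v * (z(a := 0)) v) = (\<Sum>v\<in>V. b j v * z v)" for j
          using insert.hyps by (intro sum.cong) auto
        then show "\<exists>z. \<forall>j<m. (\<Sum>v\<in>insert a V. c j v * z v) = u j"
          unfolding c using z by (intro exI[of _ "z(a := 0)"]) auto
      qed
    qed
  qed
  then show thesis using that by blast
qed

subsection \<open>Polytopality in terms of relations\<close>

text \<open>Only proper faces belong to a boundary complex, hence the strict inclusions and
  \<open>vertices K \<notin> K\<close>. The last condition says that the faces are simplices.\<close>

definition realized_by_relations :: "'a set set \<Rightarrow> ('a \<Rightarrow> real) set \<Rightarrow> bool" where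
  "realized_by_relations K \<Lambda> \<longleftrightarrow>
     function_subspace \<Lambda> \<and> (\<forall>x\<in>\<Lambda>. sum x (vertices K) = 0) \<and> vertices K \<notin> K \<and>
     (\<forall>\<sigma>. \<sigma> \<subset> vertices K \<longrightarrow> (\<sigma> \<in> K \<longleftrightarrow> relation_face \<Lambda> (vertices K) \<sigma>)) \<and>
     (\<forall>\<sigma>\<in>K. \<forall>x\<in>\<Lambda>. (\<forall>v\<in>vertices K - \<sigma>. x v = 0) \<longrightarrow> (\<forall>v\<in>vertices K. x v = 0))"

lemma realized_by_relationsD:
  assumes "realized_by_relations K \<Lambda>"
  shows "function_subspace \<Lambda>" "\<And>x. x \<in> \<Lambda> \<Longrightarrow> sum x (vertices K) = 0" "vertices K \<notin> K"
    "\<And>\<sigma>. \<sigma> \<subset> vertices K \<Longrightarrow> \<sigma> \<in> K \<longleftrightarrow> relation_face \<Lambda> (vertices K) \<sigma>"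
    "\<And>\<sigma> x. \<sigma> \<in> K \<Longrightarrow> x \<in> \<Lambda> \<Longrightarrow> \<forall>v\<in>vertices K - \<sigma>. x v = 0 \<Longrightarrow> \<forall>v\<in>vertices K. x v = 0"
    "\<And>\<sigma>. \<sigma> \<in> K \<Longrightarrow> \<sigma> \<subset> vertices K"
proof -
  show 3: "vertices K \<notin> K" using assms unfolding realized_by_relations_def by blast
  show "\<And>\<sigma>. \<sigma> \<in> K \<Longrightarrow> \<sigma> \<subset> vertices K" using 3 unfolding vertices_def by blast
qed (use assms in \<open>simp_all add: realized_by_relations_def\<close>)

text \<open>The face condition kills the coefficients off \<open>\<sigma>\<close>, after which the
  simplex condition kills those on it. In this merged form the conditions pass to links.\<close>

lemma realized_by_relations_nonneg:
  assumes "realized_by_relations K \<Lambda>" "\<sigma> \<in> K" "x \<in> \<Lambda>" "\<forall>v\<in>vertices K - \<sigma>. 0 \<le> x v"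
  shows "\<forall>v\<in>vertices K. x v = 0"
proof -
  note D = realized_by_relationsD[OF assms(1)]
  have "\<forall>v\<in>vertices K - \<sigma>. x v = 0"
    using D(4)[OF D(6)[OF assms(2)]] assms(2-4) by (simp add: relation_face_def)
  then show ?thesis by (rule D(5)[OF assms(2,3)])
qed

lemma finite_vertices: "abstract_simplicial_complex K \<Longrightarrow> finite (vertices K)"
  by (simp add: abstract_simplicial_complex_def vertices_def)

text \<open>A face corresponds to the labels of the points in it, and \<open>ext\<close> makes these
  points its extreme points. The full index set satisfies \<open>relation_face\<close> vacuously and
  stands for the polytope itself, hence the strict inclusion.\<close>

lemma boundary_complex_relation_face:
  fixes p :: "'a \<Rightarrow> 'b::real_vector"
  assumes V: "finite V" "inj_on p V" and ext: "{x. x extreme_point_of convex hull (p ` V)} = p ` V"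
  shows "boundary_complex (convex hull (p ` V)) =
    {p ` \<sigma> | \<sigma>. \<sigma> \<subset> V \<and> relation_face (affine_relations p V) V \<sigma>}"
proof -
  let ?P = "convex hull (p ` V)"
  have extF: "{v. v extreme_point_of F} = p ` {v \<in> V. p v \<in> F}" if "F face_of ?P" for F
    using extreme_point_of_face[OF that] ext by auto
  show ?thesis
  proof (intro subset_antisym subsetI)
    fix A assume "A \<in> boundary_complex ?P"
    then obtain F where F: "F face_of ?P" "F \<noteq> ?P" "A = p ` {v \<in> V. p v \<in> F}"
      using extF by (auto simp: boundary_complex_def)
    note face = face_of_convex_hull_image[OF V F(1)]
    have "{v \<in> V. p v \<in> F} \<noteq> V" using face(1) F(2) by force
    then show "A \<in> {p ` \<sigma> | \<sigma>. \<sigma> \<subset> V \<and> relation_face (affine_relations p V) V \<sigma>}"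
      using face(2) F(3) by blast
  next
    fix A assume "A \<in> {p ` \<sigma> | \<sigma>. \<sigma> \<subset> V \<and> relation_face (affine_relations p V) V \<sigma>}"
    then obtain \<sigma> where s: "A = p ` \<sigma>" "\<sigma> \<subset> V" "relation_face (affine_relations p V) V \<sigma>"
      by blast
    note face = relation_face_imp_face_of[OF V psubset_imp_subset[OF s(2)] s(3)]
    have "convex hull (p ` \<sigma>) \<noteq> ?P"
    proof
      assume eq: "convex hull (p ` \<sigma>) = ?P"
      have "V \<subseteq> \<sigma>"
        using face(2) unfolding eq by (auto intro: hull_inc)
      then show False using s(2) by blast
    qed
    then show "A \<in> boundary_complex ?P"
      using face extF[OF face(1)] s(1) unfolding boundary_complex_def by blast
  qed
qed

lemma image_in_boundary_complex_iff:
  fixes p :: "'a \<Rightarrow> 'b::real_vector"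
  assumes V: "finite V" "inj_on p V" and ext: "{x. x extreme_point_of convex hull (p ` V)} = p ` V"
    and s: "\<sigma> \<subseteq> V"
  shows "p ` \<sigma> \<in> boundary_complex (convex hull (p ` V)) \<longleftrightarrow>
    \<sigma> \<subset> V \<and> relation_face (affine_relations p V) V \<sigma>"
proof -
  have "p ` \<sigma> \<in> boundary_complex (convex hull (p ` V)) \<longleftrightarrow>
      (\<exists>\<tau>. p ` \<sigma> = p ` \<tau> \<and> \<tau> \<subset> V \<and> relation_face (affine_relations p V) V \<tau>)"
    by (simp only: boundary_complex_relation_face[OF V ext] mem_Collect_eq)
  also have "\<dots> \<longleftrightarrow> (\<exists>\<tau>. \<sigma> = \<tau> \<and> \<tau> \<subset> V \<and> relation_face (affine_relations p V) V \<tau>)"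
    using inj_on_image_eq_iff[OF V(2) s psubset_imp_subset] by (intro ex_cong1) auto
  finally show ?thesis by simp
qed

lemma affine_dependent_image_iff:
  fixes p :: "'a \<Rightarrow> 'b::real_vector"
  assumes V: "finite V" "inj_on p V" and s: "\<sigma> \<subseteq> V"
  shows "affine_dependent (p ` \<sigma>) \<longleftrightarrow>
    (\<exists>x\<in>affine_relations p V. (\<forall>v\<in>V - \<sigma>. x v = 0) \<and> (\<exists>v\<in>V. x v \<noteq> 0))"
proof -
  have fs: "finite \<sigma>" and inj: "inj_on p \<sigma>" using assms finite_subset inj_on_subset by blast+
  have sums: "sum x V = sum x \<sigma>" "(\<Sum>v\<in>V. x v *\<^sub>R p v) = (\<Sum>v\<in>\<sigma>. x v *\<^sub>R p v)"
    if "\<forall>v\<in>V - \<sigma>. x v = 0" for x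
    using V s that by (intro sum.mono_neutral_right; auto)+
  show ?thesis
  proof
    assume "affine_dependent (p ` \<sigma>)"
    then obtain U where U: "sum U (p ` \<sigma>) = 0" "\<exists>v\<in>p ` \<sigma>. U v \<noteq> 0" "(\<Sum>v\<in>p ` \<sigma>. U v *\<^sub>R v) = 0"
      using fs by (auto simp: affine_dependent_explicit_finite)
    define x where "x v = (if v \<in> \<sigma> then U (p v) else 0)" for v
    have "\<forall>v\<in>V - \<sigma>. x v = 0" by (simp add: x_def)
    moreover from sums[OF this] have "x \<in> affine_relations p V"
      using U inj by (simp add: affine_relations_def x_def sum.reindex)
    moreover have "\<exists>v\<in>V. x v \<noteq> 0" using U(2) s by (auto simp: x_def)
    ultimately show "\<exists>x\<in>affine_relations p V. (\<forall>v\<in>V - \<sigma>. x v = 0) \<and> (\<exists>v\<in>V. x v \<noteq> 0)"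
      by blast
  next
    assume "\<exists>x\<in>affine_relations p V. (\<forall>v\<in>V - \<sigma>. x v = 0) \<and> (\<exists>v\<in>V. x v \<noteq> 0)"
    then obtain x where x: "x \<in> affine_relations p V" "\<forall>v\<in>V - \<sigma>. x v = 0" "\<exists>v\<in>V. x v \<noteq> 0"
      by blast
    have *: "the_inv_into \<sigma> p (p v) = v" if "v \<in> \<sigma>" for v
      using inj that by (rule the_inv_into_f_f)
    show "affine_dependent (p ` \<sigma>)"
      using x sums[OF x(2)] fs inj s
      by (auto simp: affine_dependent_explicit_finite affine_relations_def sum.reindex *
          intro!: exI[of _ "x \<circ> the_inv_into \<sigma> p"])
  qed
qed

text \<open>A face that is the hull of an affinely independent set has its extreme points in that
  set; conversely, the labelled points of a face themselves serve as such a set.\<close>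

lemma simplicial_polytope_iff_relations:
  fixes p :: "'a \<Rightarrow> 'b::real_vector"
  assumes V: "finite V" "inj_on p V" and ext: "{x. x extreme_point_of convex hull (p ` V)} = p ` V"
  shows "simplicial_polytope (convex hull (p ` V)) \<longleftrightarrow>
    (\<forall>\<sigma>. \<sigma> \<subset> V \<and> relation_face (affine_relations p V) V \<sigma> \<longrightarrow> \<not> affine_dependent (p ` \<sigma>))"
    (is "simplicial_polytope ?P \<longleftrightarrow> ?R")
proof
  assume P: "simplicial_polytope ?P"
  show ?R
  proof (intro allI impI)
    fix \<sigma> assume s: "\<sigma> \<subset> V \<and> relation_face (affine_relations p V) V \<sigma>"
    then have "p ` \<sigma> \<in> boundary_complex ?P"
      using boundary_complex_relation_face[OF V ext] by blast
    then obtain F where F: "F face_of ?P" "F \<noteq> ?P" "p ` \<sigma> = {v. v extreme_point_of F}"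
      by (auto simp: boundary_complex_def)
    then obtain C where C: "\<not> affine_dependent C" "F = convex hull C"
      using P unfolding simplicial_polytope_def by blast
    then have "p ` \<sigma> \<subseteq> C" using F(3) extreme_points_of_convex_hull by blast
    then show "\<not> affine_dependent (p ` \<sigma>)" using C(1) affine_dependent_subset by blast
  qed
next
  assume R: ?R
  have "\<exists>C. finite C \<and> \<not> affine_dependent C \<and> F = convex hull C"
    if F: "F face_of ?P" "F \<noteq> ?P" for F
  proof -
    let ?\<sigma> = "{v \<in> V. p v \<in> F}"
    note face = face_of_convex_hull_image[OF V F(1)]
    have "?\<sigma> \<noteq> V" using face(1) F(2) by force
    then have "?\<sigma> \<subset> V" by blast
    then have "\<not> affine_dependent (p ` ?\<sigma>)" using R face(2) by simp
    then show ?thesis using face(1) V(1) by (intro exI[of _ "p ` ?\<sigma>"]) auto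
  qed
  then show "simplicial_polytope ?P"
    using V(1) unfolding simplicial_polytope_def polytope_def by blast
qed

text \<open>Nonemptiness excludes a one-point polytope, whose extreme point lies in no proper
  face.\<close>

lemma boundary_complex_vertices:
  fixes P :: "'b::real_vector set"
  assumes "vertices (boundary_complex P) \<noteq> {}"
  shows "vertices (boundary_complex P) = {x. x extreme_point_of P}"
proof (intro subset_antisym subsetI)
  fix x assume "x \<in> vertices (boundary_complex P)"
  then show "x \<in> {x. x extreme_point_of P}"
    by (auto simp: vertices_def boundary_complex_def extreme_point_of_face)
next
  fix x assume x: "x \<in> {x. x extreme_point_of P}"
  have "P \<noteq> {x}"
  proof
    assume "P = {x}"
    then have "F = {}" if "F face_of P" "F \<noteq> P" for F
      using face_of_imp_subset[OF that(1)] that(2) by blast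
    then have "vertices (boundary_complex P) = {}"
      unfolding vertices_def boundary_complex_def by force
    then show False using assms by simp
  qed
  moreover have "{x} face_of P" using x by (simp add: face_of_singleton)
  ultimately have "{v. v extreme_point_of {x}} \<in> boundary_complex P"
    unfolding boundary_complex_def by blast
  then show "x \<in> vertices (boundary_complex P)" by (auto simp: vertices_def)
qed

text \<open>The isomorphism itself labels the extreme points by the vertices of \<open>K\<close>,
  and the affine relations of this labelling are the required space. For \<open>{{}}\<close> the
  polytope would be a point, whose extreme point has no label.\<close>

lemma polytopal_imp_relations:
  fixes P :: "'b::real_vector set"
  assumes K: "abstract_simplicial_complex K" "K \<noteq> {{}}"
    and P: "simplicial_polytope P" and iso: "simplicial_iso K (boundary_complex P)"
  shows "\<exists>\<Lambda>. realized_by_relations K \<Lambda>"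
proof -
  let ?V = "vertices K"
  obtain p where p: "bij_betw p ?V (vertices (boundary_complex P))"
    "\<And>\<sigma>. \<sigma> \<subseteq> ?V \<Longrightarrow> \<sigma> \<in> K \<longleftrightarrow> p ` \<sigma> \<in> boundary_complex P"
    using iso unfolding simplicial_iso_def by blast
  have "?V \<noteq> {}" using K by (auto simp: vertices_def abstract_simplicial_complex_def)
  then have "vertices (boundary_complex P) \<noteq> {}" using p(1) by (auto simp: bij_betw_def)
  note vb = boundary_complex_vertices[OF this]
  have V: "finite ?V" "inj_on p ?V" using K(1) p(1) by (auto simp: finite_vertices bij_betw_def)
  have pV: "p ` ?V = {x. x extreme_point_of P}" using p(1) vb by (simp add: bij_betw_def)
  then have PV: "P = convex hull (p ` ?V)"
    using polytope_eq_convex_hull_extreme_points(2) P unfolding simplicial_polytope_def by metis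
  then have ext: "{x. x extreme_point_of convex hull (p ` ?V)} = p ` ?V" using pV by simp
  let ?L = "affine_relations p ?V"
  have iff: "\<sigma> \<in> K \<longleftrightarrow> \<sigma> \<subset> ?V \<and> relation_face ?L ?V \<sigma>" if s: "\<sigma> \<subseteq> ?V" for \<sigma>
    using p(2)[OF s] image_in_boundary_complex_iff[OF V ext s] PV by simp
  have "realized_by_relations K ?L"
    unfolding realized_by_relations_def
  proof (intro conjI allI impI ballI)
    fix \<sigma> x v assume s: "\<sigma> \<in> K" "x \<in> ?L" "\<forall>v\<in>?V - \<sigma>. x v = 0" "v \<in> ?V"
    then have "\<sigma> \<subset> ?V" "relation_face ?L ?V \<sigma>" using iff by (auto simp: vertices_def)
    then have "\<not> affine_dependent (p ` \<sigma>)"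
      using P simplicial_polytope_iff_relations[OF V ext] PV by simp
    then show "x v = 0"
      using affine_dependent_image_iff[OF V psubset_imp_subset[OF \<open>\<sigma> \<subset> ?V\<close>]] s by blast
  next
    show "?V \<notin> K" using iff by blast
    show "\<sigma> \<in> K \<longleftrightarrow> relation_face ?L ?V \<sigma>" if "\<sigma> \<subset> ?V" for \<sigma>
      using iff that by blast
  qed (simp_all add: function_subspace_affine_relations, simp add: affine_relations_def)
  then show ?thesis by blast
qed

lemma lookup_scaleR: "Poly_Mapping.lookup (c *\<^sub>R x) i = c *\<^sub>R Poly_Mapping.lookup x i"
proof -
  have "finite {i. c *\<^sub>R Poly_Mapping.lookup x i \<noteq> 0}"
    by (rule finite_subset[OF _ finite_lookup[of x]]) auto
  then show ?thesis by (simp add: scaleR_poly_mapping_def)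
qed

text \<open>The columns of a system of equations for \<open>\<Lambda>\<close> are taken as points,
  so that their linear relations are, on the vertices, exactly \<open>\<Lambda>\<close>. Since
  coordinate sums vanish on \<open>\<Lambda>\<close>, these are also the affine relations.\<close>

lemma relations_imp_polytopal:
  assumes K: "abstract_simplicial_complex K" and real: "realized_by_relations K \<Lambda>"
  shows "\<exists>P :: (nat \<Rightarrow>\<^sub>0 real) set. simplicial_polytope P \<and> simplicial_iso K (boundary_complex P)"
proof -
  let ?V = "vertices K"
  note realD = realized_by_relationsD[OF real]
  have fV: "finite ?V" using K by (rule finite_vertices)
  obtain m and b :: "nat \<Rightarrow> 'a \<Rightarrow> real" where
    b: "\<And>x. (\<exists>y\<in>\<Lambda>. \<forall>v\<in>?V. y v = x v) \<longleftrightarrow> (\<forall>j<m. (\<Sum>v\<in>?V. b j v * x v) = 0)"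
    by (rule function_subspace_equations[OF fV realD(1)]) iprover
  define p :: "'a \<Rightarrow> (nat \<Rightarrow>\<^sub>0 real)" where "p v = (\<Sum>j<m. Poly_Mapping.single j (b j v))" for v
  have lookup_p: "Poly_Mapping.lookup (p v) j = (if j < m then b j v else 0)" for v j
    by (simp add: p_def lookup_sum lookup_single when_def)
  have sum_p: "(\<Sum>v\<in>?V. x v *\<^sub>R p v) = 0 \<longleftrightarrow> (\<forall>j<m. (\<Sum>v\<in>?V. b j v * x v) = 0)" for x
  proof -
    have "Poly_Mapping.lookup (\<Sum>v\<in>?V. x v *\<^sub>R p v) j =
        (if j < m then \<Sum>v\<in>?V. b j v * x v else 0)" (is "Poly_Mapping.lookup ?s j = _") for j
      by (cases "j < m") (simp_all add: lookup_sum lookup_scaleR lookup_p mult.commute)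
    moreover have "?s = 0 \<longleftrightarrow> (\<forall>j. Poly_Mapping.lookup ?s j = 0)"
      by (metis lookup_zero poly_mapping_eqI)
    ultimately show ?thesis by simp
  qed
  let ?L = "affine_relations p ?V"
  have L: "x \<in> ?L \<longleftrightarrow> (\<exists>y\<in>\<Lambda>. \<forall>v\<in>?V. y v = x v)" for x
  proof -
    have "sum x ?V = 0" if y: "y \<in> \<Lambda>" "\<forall>v\<in>?V. y v = x v" for y
    proof -
      have "sum x ?V = sum y ?V" by (rule sum.cong) (use y(2) in auto)
      then show ?thesis using realD(2)[OF y(1)] by simp
    qed
    moreover have "x \<in> ?L \<longleftrightarrow> sum x ?V = 0 \<and> (\<exists>y\<in>\<Lambda>. \<forall>v\<in>?V. y v = x v)"
      by (simp only: affine_relations_def mem_Collect_eq sum_p b)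
    ultimately show ?thesis by blast
  qed
  have face_iff: "relation_face ?L ?V \<sigma> \<longleftrightarrow> relation_face \<Lambda> ?V \<sigma>" for \<sigma>
  proof
    assume "relation_face ?L ?V \<sigma>"
    moreover have "\<Lambda> \<subseteq> ?L" using L by blast
    ultimately show "relation_face \<Lambda> ?V \<sigma>" unfolding relation_face_def by blast
  next
    assume rf: "relation_face \<Lambda> ?V \<sigma>"
    show "relation_face ?L ?V \<sigma>"
      unfolding relation_face_def
    proof (intro ballI impI)
      fix x v assume x: "x \<in> ?L" "\<forall>v\<in>?V - \<sigma>. 0 \<le> x v" "v \<in> ?V - \<sigma>"
      obtain y where "y \<in> \<Lambda>" "\<forall>v\<in>?V. y v = x v" using x(1) L by blast
      then show "x v = 0" using rf x unfolding relation_face_def by force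
    qed
  qed
  have K_iff: "\<sigma> \<in> K \<longleftrightarrow> \<sigma> \<subset> ?V \<and> relation_face ?L ?V \<sigma>" for \<sigma>
    using realD(4,6) face_iff by blast
  have singleton: "{v} \<subset> ?V" "relation_face ?L ?V {v}" if "v \<in> ?V" for v
  proof -
    have "{v} \<in> K" using that K unfolding vertices_def abstract_simplicial_complex_def by blast
    then show "{v} \<subset> ?V" "relation_face ?L ?V {v}" using K_iff by blast+
  qed
  have inj: "inj_on p ?V"
  proof (rule inj_onI, rule ccontr)
    fix u v assume uv: "u \<in> ?V" "v \<in> ?V" "p u = p v" "u \<noteq> v"
    \<comment> \<open>Equal points would give a relation that is nonnegative off \<open>u\<close>
      and positive at \<open>v\<close>, against \<open>{u}\<close> being a face.\<close>
    define x where "x = (\<lambda>w. if w = v then 1 else if w = u then - 1 else 0 :: real)"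
    have split: "sum f ?V = f v + (f u + sum f (?V - {v} - {u}))" for f :: "'a \<Rightarrow> 'c::comm_monoid_add"
      using fV uv sum.remove[OF fV uv(2), of f] sum.remove[of "?V - {v}" u f] by simp
    have z: "sum x (?V - {v} - {u}) = 0" "(\<Sum>w\<in>?V - {v} - {u}. x w *\<^sub>R p w) = 0"
      by (intro sum.neutral; simp add: x_def)+
    have "x \<in> ?L"
      unfolding affine_relations_def mem_Collect_eq split[of x] split[of "\<lambda>w. x w *\<^sub>R p w"] z
      using uv(3,4) by (simp add: x_def)
    moreover have "\<forall>w\<in>?V - {u}. 0 \<le> x w" by (simp add: x_def)
    ultimately have "\<forall>w\<in>?V - {u}. x w = 0"
      using singleton(2)[OF uv(1)] unfolding relation_face_def by blast
    then have "x v = 0" using uv(2,4) by simp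
    then show False by (simp add: x_def)
  qed
  have ext: "{x. x extreme_point_of convex hull (p ` ?V)} = p ` ?V"
  proof (intro subset_antisym extreme_points_of_convex_hull subsetI)
    fix y assume "y \<in> p ` ?V"
    then obtain v where v: "v \<in> ?V" "y = p v" by blast
    then have "convex hull (p ` {v}) face_of convex hull (p ` ?V)"
      using singleton[OF v(1)] by (intro relation_face_imp_face_of fV inj) auto
    then show "y \<in> {x. x extreme_point_of convex hull (p ` ?V)}"
      using v by (simp add: face_of_singleton)
  qed
  have bc: "boundary_complex (convex hull (p ` ?V)) = {p ` \<sigma> | \<sigma>. \<sigma> \<in> K}"
    unfolding boundary_complex_relation_face[OF fV inj ext] K_iff ..
  have "simplicial_iso K (boundary_complex (convex hull (p ` ?V)))"
    unfolding simplicial_iso_def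
  proof (intro exI[of _ p] conjI allI impI)
    show "bij_betw p ?V (vertices (boundary_complex (convex hull (p ` ?V))))"
      using inj unfolding bij_betw_def bc by (auto simp: vertices_def)
    fix \<sigma> assume "\<sigma> \<subseteq> ?V"
    then show "\<sigma> \<in> K \<longleftrightarrow> p ` \<sigma> \<in> boundary_complex (convex hull (p ` ?V))"
      using image_in_boundary_complex_iff[OF fV inj ext] K_iff by simp
  qed
  moreover have "simplicial_polytope (convex hull (p ` ?V))"
    unfolding simplicial_polytope_iff_relations[OF fV inj ext]
  proof (intro allI impI)
    fix \<sigma> assume s: "\<sigma> \<subset> ?V \<and> relation_face ?L ?V \<sigma>"
    then have "\<sigma> \<in> K" using K_iff by blast
    have "x v = 0" if x: "x \<in> ?L" "\<forall>v\<in>?V - \<sigma>. x v = 0" "v \<in> ?V" for x v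
    proof -
      obtain y where y: "y \<in> \<Lambda>" "\<forall>v\<in>?V. y v = x v" using x(1) L by blast
      then have "\<forall>v\<in>?V. y v = 0" using x(2) by (intro realD(5)[OF \<open>\<sigma> \<in> K\<close>]) auto
      then show ?thesis using y(2) x(3) by simp
    qed
    then show "\<not> affine_dependent (p ` \<sigma>)"
      using affine_dependent_image_iff[OF fV inj psubset_imp_subset[OF conjunct1[OF s]]] by blast
  qed
  ultimately show ?thesis by blast
qed

subsection \<open>Relations of wreath products\<close>

text \<open>A facet only restricts the vertices all of whose copies are present: they must lie in
  \<open>F\<close>. Any other vertex has a missing copy, which \<open>c\<close> is free to
  select.\<close>

lemma wreath_iff:
  assumes K: "abstract_simplicial_complex K"
  shows "\<sigma> \<in> wreath d K \<longleftrightarrow>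
    \<sigma> \<subseteq> vertices K \<times> {..d} \<and> {v \<in> vertices K. {v} \<times> {..d} \<subseteq> \<sigma>} \<in> K"
    (is "_ \<longleftrightarrow> _ \<and> ?A \<in> K")
proof
  assume s: "\<sigma> \<in> wreath d K"
  then have sub: "\<sigma> \<subseteq> vertices K \<times> {..d}"
    using vertices_wreath[OF K] unfolding vertices_def by blast
  obtain F c where F: "F \<in> facets K" "\<forall>v \<in> vertices K - F. c v \<le> d"
    "\<sigma> \<subseteq> F \<times> {..d} \<union> {(v, i). v \<in> vertices K - F \<and> i \<le> d \<and> i \<noteq> c v}"
    using s by (auto simp: wreath_def wreath_facets_def)
  have "?A \<subseteq> F"
  proof
    fix v assume v: "v \<in> ?A"
    show "v \<in> F"
    proof (rule ccontr)
      assume "v \<notin> F"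
      then have "(v, c v) \<in> \<sigma>" using v F(2) by auto
      then show False using F(3) \<open>v \<notin> F\<close> by auto
    qed
  qed
  moreover have "F \<in> K" using F(1) by (simp add: facets_def)
  ultimately show "\<sigma> \<subseteq> vertices K \<times> {..d} \<and> ?A \<in> K"
    using sub K unfolding abstract_simplicial_complex_def by blast
next
  assume s: "\<sigma> \<subseteq> vertices K \<times> {..d} \<and> ?A \<in> K"
  obtain F where F: "F \<in> facets K" "?A \<subseteq> F" using face_subset_facet[OF K] s by blast
  have "\<exists>i\<le>d. (v, i) \<notin> \<sigma>" if "v \<in> vertices K - F" for v using F(2) that by auto
  then obtain c where c: "\<And>v. v \<in> vertices K - F \<Longrightarrow> c v \<le> d \<and> (v, c v) \<notin> \<sigma>" by metis
  have "\<sigma> \<subseteq> F \<times> {..d} \<union> {(v, i). v \<in> vertices K - F \<and> i \<le> d \<and> i \<noteq> c v}"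
    using s c by fastforce
  then show "\<sigma> \<in> wreath d K"
    using F(1) c unfolding wreath_def wreath_facets_def by blast
qed

text \<open>The relations of the points \<open>(p v, e i)\<close>, with \<open>e 0, \<dots>, e d\<close> the vertices of a simplex around the
  origin in a separate summand for each \<open>v\<close>: the coefficients must be constant in \<open>i\<close>.\<close>

lemma relations_wreath:
  assumes K: "abstract_simplicial_complex K" and real: "realized_by_relations K \<Lambda>"
  shows "realized_by_relations (wreath d K) ((\<lambda>x. x \<circ> fst) ` \<Lambda>)"
proof -
  let ?V = "vertices K" and ?L = "(\<lambda>x. x \<circ> fst) ` \<Lambda> :: ('a \<times> nat \<Rightarrow> real) set"
  define A where "A \<sigma> = {v \<in> ?V. {v} \<times> {..d} \<subseteq> \<sigma>}" for \<sigma>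
  note realD = realized_by_relationsD[OF real]
  have VW: "vertices (wreath d K) = ?V \<times> {..d}" using K by (rule vertices_wreath)
  have W: "\<sigma> \<in> wreath d K \<longleftrightarrow> \<sigma> \<subseteq> ?V \<times> {..d} \<and> A \<sigma> \<in> K" for \<sigma>
    using wreath_iff[OF K] by (simp add: A_def)
  \<comment> \<open>A pulled back function is constant on copies, so a condition on its values off
    \<open>\<sigma>\<close> concerns the vertices with a missing copy, that is, those off
    \<open>A \<sigma>\<close>.\<close>
  have off: "(\<forall>p\<in>?V \<times> {..d} - \<sigma>. Q (fst p)) \<longleftrightarrow> (\<forall>v\<in>?V - A \<sigma>. Q v)" for Q \<sigma>
  proof -
    have "?V - A \<sigma> = fst ` (?V \<times> {..d} - \<sigma>)" by (force simp: A_def)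
    then show ?thesis by simp
  qed
  have face: "relation_face ?L (?V \<times> {..d}) \<sigma> \<longleftrightarrow> relation_face \<Lambda> ?V (A \<sigma>)" for \<sigma>
    unfolding relation_face_def ball_simps
  proof (intro ball_cong refl)
    fix x
    show "((\<forall>p\<in>?V \<times> {..d} - \<sigma>. 0 \<le> (x \<circ> fst) p) \<longrightarrow> (\<forall>p\<in>?V \<times> {..d} - \<sigma>. (x \<circ> fst) p = 0)) \<longleftrightarrow>
        ((\<forall>v\<in>?V - A \<sigma>. 0 \<le> x v) \<longrightarrow> (\<forall>v\<in>?V - A \<sigma>. x v = 0))"
      unfolding o_apply using off[of \<sigma> "\<lambda>v. 0 \<le> x v"] off[of \<sigma> "\<lambda>v. x v = 0"] by simp
  qed
  have A: "A \<sigma> \<subset> ?V" if "\<sigma> \<subset> ?V \<times> {..d}" for \<sigma>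
    using that unfolding A_def by auto
  have subsp: "function_subspace ?L"
    unfolding function_subspace_def
  proof (intro conjI ballI allI)
    show "(\<lambda>_. 0) \<in> ?L"
      using function_subspace_0[OF realD(1)] by (auto simp: image_iff o_def intro!: bexI[of _ "\<lambda>_. 0"])
    fix x y c assume "x \<in> ?L" "y \<in> ?L"
    then obtain x' y' where *: "x' \<in> \<Lambda>" "y' \<in> \<Lambda>" "x = x' \<circ> fst" "y = y' \<circ> fst" by blast
    show "(\<lambda>v. x v + c * y v) \<in> ?L"
      using function_subspace_comb[OF realD(1) *(1,2), of c] unfolding *(3,4)
      by (auto simp: image_iff o_def intro!: bexI[of _ "\<lambda>v. x' v + c * y' v"])
  qed
  have sum0: "sum (x \<circ> fst) (?V \<times> {..d}) = 0" if "x \<in> \<Lambda>" for x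
    using realD(2)[OF that] by (simp add: sum.cartesian_product' sum_distrib_left[symmetric])
  show ?thesis
    unfolding realized_by_relations_def VW
  proof (intro conjI allI impI ballI)
    show "?V \<times> {..d} \<notin> wreath d K"
    proof
      assume "?V \<times> {..d} \<in> wreath d K"
      moreover have "A (?V \<times> {..d}) = ?V" unfolding A_def by auto
      ultimately show False using realD(3) unfolding W by simp
    qed
    fix \<sigma> assume "\<sigma> \<subset> ?V \<times> {..d}"
    then show "\<sigma> \<in> wreath d K \<longleftrightarrow> relation_face ?L (?V \<times> {..d}) \<sigma>"
      unfolding face W using realD(4)[OF A] by blast
  next
    fix \<sigma> x v
    assume s: "\<sigma> \<in> wreath d K" "x \<in> ?L" "\<forall>v\<in>?V \<times> {..d} - \<sigma>. x v = 0" "v \<in> ?V \<times> {..d}"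
    then obtain y where y: "y \<in> \<Lambda>" "x = y \<circ> fst" by blast
    have "\<forall>v\<in>?V - A \<sigma>. y v = 0" using s(3) off[of \<sigma> "\<lambda>v. y v = 0"] y(2) by simp
    then have "\<forall>v\<in>?V. y v = 0" using realD(5)[OF _ y(1)] s(1) W by blast
    then show "x v = 0" using s(4) y(2) by auto
  qed (use subsp sum0 in auto)
qed

text \<open>\<open>K\<close> is the link of the face \<open>vertices K \<times> {1..d}\<close> of the wreath product, and forming a link
  restricts relations to the remaining vertices. The restricted coefficients need not sum to 0, which
  the weights from Stiemke's lemma repair.\<close>

lemma relations_of_wreath:
  assumes K: "abstract_simplicial_complex K" and real: "realized_by_relations (wreath d K) \<Lambda>"
  shows "\<exists>\<Lambda>'. realized_by_relations K \<Lambda>'"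
proof -
  let ?V = "vertices K"
  have VW: "vertices (wreath d K) = ?V \<times> {..d}" using K by (rule vertices_wreath)
  note realD = realized_by_relationsD[OF real, unfolded VW]
  note nonneg = realized_by_relations_nonneg[OF real, unfolded VW]
  define N where "N = (\<lambda>x v. x (v, 0::nat)) ` \<Lambda>"
  \<comment> \<open>With the other copies of all vertices filled in, a vertex is complete exactly
    when its copy 0 is present, so copy 0 plays the part of the vertex in \<open>K\<close>.\<close>
  define B where "B \<sigma> = ?V \<times> {1..d} \<union> \<sigma> \<times> {0}" for \<sigma> :: "'a set"
  have VB: "?V \<times> {..d} - B \<sigma> = (?V - \<sigma>) \<times> {0}" for \<sigma>
    unfolding B_def by (auto simp: Suc_le_eq)
  have BW: "B \<sigma> \<in> wreath d K \<longleftrightarrow> \<sigma> \<in> K" if "\<sigma> \<subseteq> ?V" for \<sigma>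
  proof -
    have "B \<sigma> \<subseteq> ?V \<times> {..d}" using that unfolding B_def by auto
    moreover have "{v \<in> ?V. {v} \<times> {..d} \<subseteq> B \<sigma>} = \<sigma>"
      using that unfolding B_def by (auto simp: Suc_le_eq)
    ultimately show ?thesis by (simp add: wreath_iff[OF K])
  qed
  have Nsub: "function_subspace N"
    unfolding function_subspace_def
  proof (intro conjI ballI allI)
    show "(\<lambda>_. 0) \<in> N"
      using function_subspace_0[OF realD(1)] by (auto simp: N_def image_iff intro!: bexI[of _ "\<lambda>_. 0"])
    fix x y c assume "x \<in> N" "y \<in> N"
    then obtain x' y' where *: "x' \<in> \<Lambda>" "y' \<in> \<Lambda>" "x = (\<lambda>v. x' (v, 0))" "y = (\<lambda>v. y' (v, 0))"
      unfolding N_def by blast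
    show "(\<lambda>v. x v + c * y v) \<in> N"
      using function_subspace_comb[OF realD(1) *(1,2), of c] unfolding *(3,4) N_def
      by (auto simp: image_iff intro!: bexI[of _ "\<lambda>v. x' v + c * y' v"])
  qed
  \<comment> \<open>A relation of the wreath product that restricts to \<open>x\<close> is
    nonnegative off the face \<open>B \<sigma>\<close>, hence zero at all its vertices and not only
    off that face.\<close>
  have Nzero: "\<forall>v\<in>?V. x v = 0" if s: "\<sigma> \<in> K" "x \<in> N" "\<forall>v\<in>?V - \<sigma>. 0 \<le> x v" for \<sigma> x
  proof -
    obtain y where y: "y \<in> \<Lambda>" "x = (\<lambda>v. y (v, 0))" using s(2) unfolding N_def by blast
    have "\<sigma> \<subseteq> ?V" using s(1) by (auto simp: vertices_def)
    then have "B \<sigma> \<in> wreath d K" using s(1) BW by blast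
    moreover have "\<forall>v\<in>?V \<times> {..d} - B \<sigma>. 0 \<le> y v" unfolding VB using s(3) y(2) by auto
    ultimately have "\<forall>v\<in>?V \<times> {..d}. y v = 0" using nonneg y(1) by blast
    then show ?thesis using y(2) by auto
  qed
  \<comment> \<open>For the empty face, \<open>Nzero\<close> is the hypothesis of
    \<open>stiemke\<close>.\<close>
  have "{} \<in> K" using K unfolding abstract_simplicial_complex_def by blast
  then have "\<forall>v\<in>?V. x v = 0" if "x \<in> N" "\<forall>v\<in>?V. 0 \<le> x v" for x using Nzero that by blast
  then obtain w where w: "\<forall>v\<in>?V. 0 < w v" "\<forall>x\<in>N. (\<Sum>v\<in>?V. w v * x v) = (0::real)"
    using stiemke[OF finite_vertices[OF K] Nsub] by blast
  \<comment> \<open>Zero sum of the weighted relations is orthogonality of \<open>w\<close> to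
    \<open>N\<close>; positive weights preserve signs and zeros, hence the face conditions.\<close>
  let ?L = "(\<lambda>x v. w v * x v) ` N"
  have sgn: "0 \<le> w v * x v \<longleftrightarrow> 0 \<le> x v" "w v * x v = 0 \<longleftrightarrow> x v = 0" if "v \<in> ?V" for v x
    using w(1) that by (auto simp: zero_le_mult_iff)
  have "realized_by_relations K ?L"
    unfolding realized_by_relations_def
  proof (intro conjI allI impI ballI)
    show "function_subspace ?L"
      unfolding function_subspace_def
    proof (intro conjI ballI allI)
      show "(\<lambda>_. 0) \<in> ?L"
        using function_subspace_0[OF Nsub] by (auto simp: image_iff intro!: bexI[of _ "\<lambda>_. 0"])
      fix x y c assume "x \<in> ?L" "y \<in> ?L"
      then obtain x' y' where *: "x' \<in> N" "y' \<in> N" "x = (\<lambda>v. w v * x' v)" "y = (\<lambda>v. w v * y' v)"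
        by blast
      show "(\<lambda>v. x v + c * y v) \<in> ?L"
        using function_subspace_comb[OF Nsub *(1,2), of c] unfolding *(3,4)
        by (auto simp: image_iff algebra_simps intro!: bexI[of _ "\<lambda>v. x' v + c * y' v"])
    qed
    show "?V \<notin> K"
    proof
      assume "?V \<in> K"
      then have "B ?V \<in> wreath d K" using BW by blast
      moreover have "B ?V = ?V \<times> {..d}" unfolding B_def by (auto simp: Suc_le_eq)
      ultimately show False using realD(3) by simp
    qed
  next
    fix \<sigma> assume s: "\<sigma> \<subset> ?V"
    show "\<sigma> \<in> K \<longleftrightarrow> relation_face ?L ?V \<sigma>"
    proof
      assume "\<sigma> \<in> K"
      then have "\<forall>v\<in>?V - \<sigma>. x v = 0" if "x \<in> N" "\<forall>v\<in>?V - \<sigma>. 0 \<le> w v * x v" for x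
        using Nzero[of \<sigma> x] sgn(1)[of _ x] that by blast
      then show "relation_face ?L ?V \<sigma>"
        unfolding relation_face_def by simp
    next
      assume r: "relation_face ?L ?V \<sigma>"
      have rL: "\<And>x. x \<in> ?L \<Longrightarrow> \<forall>v\<in>?V - \<sigma>. 0 \<le> x v \<Longrightarrow> \<forall>v\<in>?V - \<sigma>. x v = 0"
        by (rule mp[OF bspec[OF r[unfolded relation_face_def]]])
      have "B \<sigma> \<subset> ?V \<times> {..d}"
        using s VB[of \<sigma>] unfolding B_def by fastforce
      moreover have "relation_face \<Lambda> (?V \<times> {..d}) (B \<sigma>)"
        unfolding relation_face_def VB
      proof (intro ballI impI)
        fix x and p :: "'a \<times> nat"
        assume x: "x \<in> \<Lambda>" "\<forall>v\<in>(?V - \<sigma>) \<times> {0}. 0 \<le> x v" "p \<in> (?V - \<sigma>) \<times> {0}"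
        have "(\<lambda>v. w v * x (v, 0)) \<in> ?L"
          unfolding N_def image_image using x(1) by (intro image_eqI[of _ _ x]) simp_all
        moreover have "\<forall>v\<in>?V - \<sigma>. 0 \<le> w v * x (v, 0)"
          using x(2) w(1) by (simp add: less_imp_le)
        ultimately have "\<forall>v\<in>?V - \<sigma>. w v * x (v, 0) = 0" by (rule rL)
        moreover obtain v where "p = (v, 0)" "v \<in> ?V - \<sigma>" using x(3) by blast
        ultimately show "x p = 0" using sgn(2)[of v "\<lambda>v. x (v, 0)"] by simp
      qed
      ultimately have "B \<sigma> \<in> wreath d K" by (simp add: realD(4))
      then show "\<sigma> \<in> K" using BW[of \<sigma>] s by simp
    qed
  next
    fix \<sigma> x v assume s: "\<sigma> \<in> K" "x \<in> ?L" "\<forall>v\<in>?V - \<sigma>. x v = 0" "v \<in> ?V"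
    then obtain y where y: "y \<in> N" "x = (\<lambda>v. w v * y v)" by (elim imageE)
    have "0 \<le> y v" if "v \<in> ?V - \<sigma>" for v
      using s(3)[unfolded y(2)] sgn(2)[of v y] that by simp
    then have "\<forall>v\<in>?V - \<sigma>. 0 \<le> y v" by blast
    then have "\<forall>v\<in>?V. y v = 0" by (rule Nzero[OF s(1) y(1)])
    then show "x v = 0" using y(2) s(4) by simp
  next
    fix x assume "x \<in> ?L"
    then show "sum x ?V = 0" using w(2) by (simp only: image_iff) force
  qed
  then show ?thesis by (rule exI)
qed

subsection \<open>Projection to the sphere\<close>

text \<open>If \<open>\<Lambda>\<close> are the affine relations of points, \<open>shifts \<Lambda>\<close> are their linear relations once the
  barycentre has been moved to the origin.\<close>

definition shifts :: "('a \<Rightarrow> real) set \<Rightarrow> ('a \<Rightarrow> real) set" where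
  "shifts \<Lambda> = {(\<lambda>v. x v + c) | x c. x \<in> \<Lambda>}"

lemma shiftsI: "x \<in> \<Lambda> \<Longrightarrow> (\<lambda>v. x v + c) \<in> shifts \<Lambda>"
  by (auto simp: shifts_def)

lemma shiftsE:
  assumes "y \<in> shifts \<Lambda>"
  obtains x c where "x \<in> \<Lambda>" "y = (\<lambda>v. x v + c)"
  using assms by (auto simp: shifts_def)

lemma function_subspace_shifts:
  assumes "function_subspace \<Lambda>"
  shows "function_subspace (shifts \<Lambda>)"
  unfolding function_subspace_def
proof (intro conjI ballI allI)
  show "(\<lambda>_. 0) \<in> shifts \<Lambda>"
    using shiftsI[OF function_subspace_0[OF assms], of 0] by simp
  fix x y :: "'a \<Rightarrow> real" and c assume "x \<in> shifts \<Lambda>" "y \<in> shifts \<Lambda>"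
  then obtain x' y' a b where *: "x' \<in> \<Lambda>" "y' \<in> \<Lambda>" "x = (\<lambda>v. x' v + a)" "y = (\<lambda>v. y' v + b)"
    by (elim shiftsE)
  have "(\<lambda>v. x v + c * y v) = (\<lambda>v. (x' v + c * y' v) + (a + c * b))"
    using * by (simp add: algebra_simps)
  then show "(\<lambda>v. x v + c * y v) \<in> shifts \<Lambda>"
    using shiftsI[OF function_subspace_comb[OF assms *(1,2), of c]] by simp
qed

text \<open>Coordinates outside \<open>A\<close> are pinned to 0, so Tychonoff's theorem applies to
  the whole product, even for infinite \<open>'a\<close>.\<close>

lemma compact_coordinate_box:
  "compact {x :: 'a \<Rightarrow> real. \<forall>v. x v \<in> (if v \<in> A then {0..r} else {0})}"
proof -
  let ?S = "\<lambda>v. if v \<in> A then {0..r} else {0 :: real}"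
  have "compactin (product_topology (\<lambda>_::'a. euclideanreal) UNIV) (PiE UNIV ?S)"
    unfolding compactin_PiE by auto
  moreover have "PiE UNIV ?S = {x. \<forall>v. x v \<in> ?S v}" by (auto simp: PiE_def Pi_def)
  ultimately show ?thesis by (simp only: euclidean_product_topology compactin_euclidean_iff)
qed

lemma continuous_on_weighted_sum:
  fixes f :: "'a \<Rightarrow> real"
  shows "continuous_on S (\<lambda>x. \<Sum>v\<in>V. f v * x v)"
  by (intro continuous_on_sum continuous_on_mult_left
      continuous_on_subset[OF continuous_on_product_coordinates]) simp

lemma closed_affine_subspace:
  assumes "finite V" "function_subspace M"
  shows "closed {x :: 'a \<Rightarrow> real. \<exists>y\<in>M. \<forall>v\<in>V. x v = z v + y v}"
proof -
  obtain m and b :: "nat \<Rightarrow> 'a \<Rightarrow> real" where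
    b: "\<And>x. (\<exists>y\<in>M. \<forall>v\<in>V. y v = x v) \<longleftrightarrow> (\<forall>j<m. (\<Sum>v\<in>V. b j v * x v) = 0)"
    by (rule function_subspace_equations[OF assms]) iprover
  have "(\<exists>y\<in>M. \<forall>v\<in>V. x v = z v + y v) \<longleftrightarrow>
      (\<forall>j\<in>{..<m}. (\<Sum>v\<in>V. b j v * x v) = (\<Sum>v\<in>V. b j v * z v))" for x
  proof -
    have "(\<exists>y\<in>M. \<forall>v\<in>V. x v = z v + y v) \<longleftrightarrow> (\<exists>y\<in>M. \<forall>v\<in>V. y v = x v - z v)"
      by (intro bex_cong ball_cong refl) auto
    also have "\<dots> \<longleftrightarrow> (\<forall>j<m. (\<Sum>v\<in>V. b j v * (x v - z v)) = 0)" by (rule b)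
    finally show ?thesis by (auto simp: right_diff_distrib sum_subtractf)
  qed
  then have "{x. \<exists>y\<in>M. \<forall>v\<in>V. x v = z v + y v} =
      (\<Inter>j\<in>{..<m}. {x. (\<Sum>v\<in>V. b j v * x v) = (\<Sum>v\<in>V. b j v * z v)})"
    by auto
  also have "closed \<dots>"
    by (intro closed_INT ballI closed_Collect_eq continuous_on_weighted_sum continuous_on_const)
  finally show ?thesis .
qed

text \<open>The set \<open>Q\<close> need not be bounded; cutting it at the sum of one member
  \<open>q\<close> bounds every coordinate, and compactness then gives the minimum.\<close>

lemma nonneg_representative_minimal_sum:
  fixes z :: "'a \<Rightarrow> real"
  assumes V: "finite V" and \<Lambda>: "function_subspace \<Lambda>"
  defines "Q \<equiv> {x. (\<forall>v\<in>V. 0 \<le> x v) \<and> (\<forall>v. v \<notin> V \<longrightarrow> x v = 0) \<and>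
    (\<exists>y\<in>shifts \<Lambda>. \<forall>v\<in>V. x v = z v + y v)}"
  obtains x where "x \<in> Q" "\<And>y. y \<in> Q \<Longrightarrow> sum x V \<le> sum y V"
proof -
  \<comment> \<open>Constants lie in \<open>shifts \<Lambda>\<close>, and adding this one makes
    \<open>z\<close> nonnegative on \<open>V\<close>.\<close>
  let ?C = "\<Sum>v\<in>V. \<bar>z v\<bar>"
  define q where "q v = (if v \<in> V then z v + ?C else 0)" for v
  have "(\<lambda>v. 0 + ?C) \<in> shifts \<Lambda>" by (rule shiftsI[OF function_subspace_0[OF \<Lambda>]])
  moreover have "0 \<le> z v + ?C" if "v \<in> V" for v
    using V member_le_sum[where i = v and A = V and f = "\<lambda>v. \<bar>z v\<bar>"] that by simp
  ultimately have q: "q \<in> Q" unfolding Q_def q_def by auto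
  define B where "B = {x. \<forall>v. x v \<in> (if v \<in> V then {0..sum q V} else {0})} \<inter>
    {x. \<exists>y\<in>shifts \<Lambda>. \<forall>v\<in>V. x v = z v + y v}"
  have BQ: "B \<subseteq> Q" unfolding B_def Q_def by (auto split: if_splits)
  have QB: "x \<in> B" if x: "x \<in> Q" "sum x V \<le> sum q V" for x
  proof -
    have "x v \<le> sum q V" if "v \<in> V" for v
      using V member_le_sum[where i = v and A = V and f = x] that x unfolding Q_def by auto
    then show ?thesis using x unfolding B_def Q_def by auto
  qed
  have "compact B"
    unfolding B_def
    by (intro compact_Int_closed compact_coordinate_box closed_affine_subspace V
        function_subspace_shifts \<Lambda>)
  moreover have "B \<noteq> {}" using QB q by blast
  moreover have "continuous_on B (\<lambda>x. sum x V)"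
    using continuous_on_weighted_sum[where S = B and V = V and f = "\<lambda>_. 1"] by simp
  ultimately obtain x where x: "x \<in> B" "\<forall>y\<in>B. sum x V \<le> sum y V"
    using continuous_attains_inf by blast
  have "sum x V \<le> sum y V" if "y \<in> Q" for y
    using x(2) QB[OF that] QB[OF q] by force
  then show thesis using x(1) BQ that by blast
qed

text \<open>Every ray from the barycentre meets the boundary: a nonnegative representative of minimal sum,
  and among these of maximal support, is supported on a face.\<close>

lemma nonneg_representative:
  fixes z :: "'a \<Rightarrow> real"
  assumes K: "abstract_simplicial_complex K" and real: "realized_by_relations K \<Lambda>"
  obtains x y where "\<And>v. 0 \<le> x v" "{v. x v \<noteq> 0} \<in> K" "y \<in> shifts \<Lambda>"
    "\<forall>v\<in>vertices K. x v = z v + y v"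
proof -
  let ?V = "vertices K"
  note realD = realized_by_relationsD[OF real]
  have fV: "finite ?V" using K by (rule finite_vertices)
  define Q where "Q = {x. (\<forall>v\<in>?V. 0 \<le> x v) \<and> (\<forall>v. v \<notin> ?V \<longrightarrow> x v = 0) \<and>
    (\<exists>y\<in>shifts \<Lambda>. \<forall>v\<in>?V. x v = z v + y v)}"
  define R where "R x \<longleftrightarrow> x \<in> Q \<and> (\<forall>y\<in>Q. sum x ?V \<le> sum y ?V)" for x
  define s where "s x = {v. x v \<noteq> 0}" for x :: "'a \<Rightarrow> real"
  obtain x0 where "R x0"
    by (rule nonneg_representative_minimal_sum[OF fV realD(1), of z, folded Q_def]) (auto simp: R_def)
  moreover have sV: "s x \<subseteq> ?V" if "R x" for x
    using that unfolding R_def Q_def s_def by blast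
  then have "\<forall>x. R x \<longrightarrow> card (s x) < Suc (card ?V)"
    using fV by (simp add: card_mono less_Suc_eq_le)
  ultimately obtain x where x: "R x" and max: "\<And>y. R y \<Longrightarrow> card (s y) \<le> card (s x)"
    using ex_has_greatest_nat[of R x0 "\<lambda>x. card (s x)"] by blast
  have Qx: "\<forall>v\<in>?V. 0 \<le> x v" "\<forall>v. v \<notin> ?V \<longrightarrow> x v = 0" and xmin: "\<forall>y\<in>Q. sum x ?V \<le> sum y ?V"
    using x unfolding R_def Q_def by auto
  obtain y where y: "y \<in> shifts \<Lambda>" "\<forall>v\<in>?V. x v = z v + y v"
    using x unfolding R_def Q_def by blast
  have Q_shift: "(\<lambda>v. if v \<in> ?V then x v + u v else 0) \<in> Q"
    if u: "u \<in> shifts \<Lambda>" "\<forall>v\<in>?V. 0 \<le> x v + u v" for u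
  proof -
    have "(\<lambda>v. y v + 1 * u v) \<in> shifts \<Lambda>"
      by (rule function_subspace_comb[OF function_subspace_shifts[OF realD(1)] y(1) u(1)])
    then show ?thesis using y(2) u(2) unfolding Q_def by (auto simp: algebra_simps)
  qed
  have "?V \<noteq> {}" using realD(3) K unfolding abstract_simplicial_complex_def by auto
  \<comment> \<open>Full support would leave room to subtract a positive constant, which lies in
    \<open>shifts \<Lambda>\<close>, and so to lower the minimal sum.\<close>
  have "s x \<noteq> ?V"
  proof
    assume eq: "s x = ?V"
    define e where "e = Min (x ` ?V)"
    have "e \<in> x ` ?V" unfolding e_def using fV \<open>?V \<noteq> {}\<close> by (intro Min_in) auto
    then have e: "0 < e" using Qx eq unfolding s_def by force
    have le: "\<forall>v\<in>?V. e \<le> x v" unfolding e_def using fV by auto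
    have "(\<lambda>v. 0 + - e) \<in> shifts \<Lambda>" by (rule shiftsI[OF function_subspace_0[OF realD(1)]])
    then have "(\<lambda>v. if v \<in> ?V then x v + - e else 0) \<in> Q" using Q_shift[of "\<lambda>_. - e"] le by simp
    then have "sum x ?V \<le> (\<Sum>v\<in>?V. if v \<in> ?V then x v + - e else 0)" using xmin by blast
    also have "\<dots> = (\<Sum>v\<in>?V. x v + - e)" by (intro sum.cong) auto
    also have "\<dots> = sum x ?V - real (card ?V) * e" by (simp add: sum_subtractf)
    finally show False using e fV \<open>?V \<noteq> {}\<close> by (simp add: mult_le_0_iff card_gt_0_iff)
  qed
  then have sub: "s x \<subset> ?V" using sV[OF x] by blast
  \<comment> \<open>Otherwise some relation \<open>u\<close> is nonnegative off the support and
    positive at a vertex \<open>w\<close> there. A small multiple of it keeps the sum, since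
    relations sum to 0, and enlarges the support, against maximality.\<close>
  have "s x \<in> K"
  proof (rule ccontr)
    assume "s x \<notin> K"
    then have "\<not> relation_face \<Lambda> ?V (s x)" using realD(4)[OF sub] by blast
    then obtain u w where u: "u \<in> \<Lambda>" "\<forall>v\<in>?V - s x. 0 \<le> u v" "w \<in> ?V - s x" "u w \<noteq> 0"
      unfolding relation_face_def by blast
    have fs: "finite (s x)" using fV sub finite_subset by blast
    have pos: "0 < x v" if "v \<in> s x" for v
      using that sub Qx(1) unfolding s_def by force
    \<comment> \<open>Every ratio is at most \<open>S\<close>, so the factor
      \<open>1 / (1 + S)\<close> keeps the perturbation below \<open>x v\<close>. A sum in place of
      a maximum also covers empty support.\<close>
    define S where "S = (\<Sum>v\<in>s x. \<bar>u v\<bar> / x v)"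
    have S0: "0 \<le> S" unfolding S_def using pos by (intro sum_nonneg) (simp add: less_imp_le)
    define e where "e = 1 / (1 + S)"
    have e0: "0 < e" using S0 by (simp add: e_def)
    have gt: "0 < x v + e * u v" if v: "v \<in> s x" for v
    proof -
      have "\<bar>u v\<bar> / x v \<le> S"
        unfolding S_def using fs pos v by (intro member_le_sum) (auto simp: less_imp_le)
      then have "\<bar>u v\<bar> < (1 + S) * x v" using pos[OF v] by (simp add: field_simps)
      then have "\<bar>u v\<bar> / (1 + S) < x v" using S0 by (simp add: pos_divide_less_eq mult.commute)
      then have "e * \<bar>u v\<bar> < x v" by (simp add: e_def)
      moreover have "- (e * \<bar>u v\<bar>) \<le> e * u v"
        using mult_left_mono[of "- \<bar>u v\<bar>" "u v" e] e0 by simp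
      ultimately show ?thesis by linarith
    qed
    have x0: "x v = 0" if "v \<in> ?V - s x" for v using that unfolding s_def by simp
    define x' where "x' v = (if v \<in> ?V then x v + e * u v else 0)" for v
    have "(\<lambda>v. e * u v + 0) \<in> shifts \<Lambda>"
      by (rule shiftsI[OF function_subspace_scale[OF realD(1) u(1)]])
    moreover have "0 \<le> x v + e * u v" if "v \<in> ?V" for v
      using gt[of v] x0[of v] u(2) that e0 by (cases "v \<in> s x") auto
    ultimately have "x' \<in> Q" using Q_shift[of "\<lambda>v. e * u v"] unfolding x'_def by simp
    moreover have "sum x' ?V = sum x ?V"
      using realD(2)[OF u(1)] by (simp add: x'_def sum.distrib flip: sum_distrib_left)
    ultimately have "R x'" using xmin unfolding R_def by simp
    have "s x \<subseteq> s x'" using gt sub unfolding s_def[of x'] x'_def by force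
    moreover have "w \<in> s x'" using u e0 x0[of w] unfolding s_def[of x'] x'_def by auto
    ultimately have "s x \<subset> s x'" using u(3) by blast
    then have "card (s x) < card (s x')"
      using sV[OF \<open>R x'\<close>] fV finite_subset psubset_card_mono by metis
    then show False using max[OF \<open>R x'\<close>] by simp
  qed
  moreover have "0 \<le> x v" for v using Qx by (cases "v \<in> ?V") auto
  ultimately show thesis using that y unfolding s_def by blast
qed

text \<open>This is injectivity of the central projection and, for \<open>r = 0\<close>, the fact
  that no point is sent to the origin. The constant \<open>c\<close> of the shift is
  \<open>1 - r\<close> divided by the number of vertices, hence nonnegative. So \<open>u\<close> is
  nonpositive off the support of \<open>x\<close>, which is a face, and must vanish; a positive
  \<open>c\<close> would then give \<open>x\<close> full support.\<close>

lemma realization_point_unique: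
  assumes K: "abstract_simplicial_complex K" and real: "realized_by_relations K \<Lambda>"
    and x: "\<And>v. 0 \<le> x v" "{v. x v \<noteq> 0} \<in> K" "sum x (vertices K) = 1"
    and y: "\<And>v. 0 \<le> y v" "{v. y v \<noteq> 0} \<in> K" "sum y (vertices K) = 1"
    and r: "0 \<le> r" "r \<le> 1"
    and eq: "\<exists>u\<in>shifts \<Lambda>. \<forall>v\<in>vertices K. u v = x v - r * y v"
  shows "r = 1 \<and> x = y"
proof -
  let ?V = "vertices K"
  note realD = realized_by_relationsD[OF real]
  have fV: "finite ?V" using K by (rule finite_vertices)
  have "?V \<noteq> {}" using realD(3) K unfolding abstract_simplicial_complex_def by auto
  then have cV: "0 < real (card ?V)" using fV by (simp add: card_gt_0_iff)
  obtain u c where u: "u \<in> \<Lambda>" "\<forall>v\<in>?V. u v + c = x v - r * y v"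
    using eq by (auto elim: shiftsE)
  have "(\<Sum>v\<in>?V. u v + c) = (\<Sum>v\<in>?V. x v - r * y v)" using u(2) by (intro sum.cong) auto
  then have c: "real (card ?V) * c = 1 - r"
    using realD(2)[OF u(1)] x(3) y(3) by (simp add: sum.distrib sum_subtractf flip: sum_distrib_left)
  then have c0: "0 \<le> c" using r cV by (metis diff_ge_0_iff_ge zero_le_mult_iff not_less)
  have "\<forall>v\<in>?V. - 1 * u v = 0"
  proof (rule realized_by_relations_nonneg[OF real x(2)])
    show "(\<lambda>v. - 1 * u v) \<in> \<Lambda>" by (rule function_subspace_scale[OF realD(1) u(1)])
    show "\<forall>v\<in>?V - {v. x v \<noteq> 0}. 0 \<le> - 1 * u v"
    proof
      fix v assume v: "v \<in> ?V - {v. x v \<noteq> 0}"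
      then have "u v + c = - (r * y v)" using u(2) by auto
      then show "0 \<le> - 1 * u v" using c0 r(1) y(1)[of v] mult_nonneg_nonneg[of r "y v"] by linarith
    qed
  qed
  then have xy: "x v = r * y v + c" if "v \<in> ?V" for v using u(2) that by auto
  have "c = 0"
  proof (rule ccontr)
    assume "c \<noteq> 0"
    then have "x v \<noteq> 0" if "v \<in> ?V" for v
      using xy[OF that] c0 r(1) y(1)[of v] mult_nonneg_nonneg[of r "y v"] by linarith
    then have "?V \<subseteq> {v. x v \<noteq> 0}" by blast
    then show False using realD(6)[OF x(2)] by blast
  qed
  then have r1: "r = 1" using c by simp
  have "x v = y v" for v
  proof (cases "v \<in> ?V")
    case True
    then show ?thesis using xy \<open>c = 0\<close> r1 by simp
  next
    case False
    then have "x v = 0" "y v = 0" using x(2) y(2) unfolding vertices_def by blast+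
    then show ?thesis by simp
  qed
  then show ?thesis using r1 by blast
qed

section \<open>The geometric realization as a compact set, and its homeomorphism with a
  sphere\<close>

definition realization_points :: "'a set set \<Rightarrow> ('a \<Rightarrow> real) set" where
  "realization_points K =
     {x. {v. x v \<noteq> 0} \<in> K \<and> (\<forall>v. 0 \<le> x v) \<and> sum x (vertices K) = 1}"

text \<open>Replacing the sum over the varying support by one over the fixed vertex set turns the
  normalisation into a single linear equation, which is a closed condition.\<close>

lemma geometric_realization_eq:
  assumes "abstract_simplicial_complex K"
  shows "geometric_realization K = top_of_set (realization_points K)"
proof -
  have "(\<Sum>v | x v \<noteq> 0. x v) = sum x (vertices K)" if "{v. x v \<noteq> 0} \<in> K" for x :: "'a \<Rightarrow> real"
    using that finite_vertices[OF assms]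
    by (intro sum.mono_neutral_left) (auto simp: vertices_def)
  then have "{x. {v. x v \<noteq> 0} \<in> K \<and> (\<forall>v. 0 \<le> x v) \<and> (\<Sum>v | x v \<noteq> 0. x v) = 1} =
      realization_points K"
    unfolding realization_points_def by auto
  then show ?thesis
    unfolding geometric_realization_def euclidean_product_topology by simp
qed

text \<open>The set is a finite union of closed simplices, one for each face, and each is a box cut
  by the sum equation.\<close>

lemma compact_realization_points:
  assumes K: "abstract_simplicial_complex K"
  shows "compact (realization_points K)"
proof -
  let ?V = "vertices K"
  define B where "B \<sigma> = {x :: 'a \<Rightarrow> real. \<forall>v. x v \<in> (if v \<in> \<sigma> then {0..1} else {0})} \<inter>
    {x. (\<Sum>v\<in>?V. 1 * x v) = 1}" for \<sigma>
  have fV: "finite ?V" using K by (rule finite_vertices)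
  have fK: "finite K"
    using K by (auto simp: abstract_simplicial_complex_def intro: finite_UnionD)
  have "x \<in> (\<Union>\<sigma>\<in>K. B \<sigma>)" if x: "x \<in> realization_points K" for x
  proof (rule UN_I)
    show "{v. x v \<noteq> 0} \<in> K" using x by (simp add: realization_points_def)
    have "x v \<le> 1" if "x v \<noteq> 0" for v
    proof -
      have "v \<in> ?V" using x that unfolding realization_points_def vertices_def by blast
      then have "x v \<le> sum x ?V"
        using fV x by (intro member_le_sum) (auto simp: realization_points_def)
      then show ?thesis using x by (simp add: realization_points_def)
    qed
    then show "x \<in> B {v. x v \<noteq> 0}"
      using x by (auto simp: B_def realization_points_def)
  qed
  moreover have "x \<in> realization_points K" if x: "\<sigma> \<in> K" "x \<in> B \<sigma>" for \<sigma> x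
  proof -
    have *: "x v \<in> (if v \<in> \<sigma> then {0..1} else {0})" for v using x(2) unfolding B_def by blast
    have "{v. x v \<noteq> 0} \<subseteq> \<sigma>" "0 \<le> x v" for v using * by (fastforce split: if_splits)+
    moreover from this have "{v. x v \<noteq> 0} \<in> K"
      using K x(1) unfolding abstract_simplicial_complex_def by blast
    ultimately show ?thesis using x(2) by (simp add: realization_points_def B_def)
  qed
  ultimately have "realization_points K = (\<Union>\<sigma>\<in>K. B \<sigma>)" by blast
  also have "compact \<dots>"
    unfolding B_def
    by (intro compact_UN fK ballI compact_Int_closed compact_coordinate_box closed_Collect_eq
        continuous_on_weighted_sum continuous_on_const)
  finally show ?thesis .
qed

lemma compact_homeomorphic_space:
  fixes f :: "'a::topological_space \<Rightarrow> 'b::t2_space"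
  assumes "compact S" "continuous_on S f" "f ` S = T" "inj_on f S"
  shows "top_of_set S homeomorphic_space top_of_set T"
proof -
  obtain g where "homeomorphism S T f g" using homeomorphism_compact[OF assms] by blast
  then show ?thesis
    unfolding homeomorphic_space_def homeomorphic_maps_def homeomorphism_def
    by (intro exI[of _ f] exI[of _ g]) auto
qed

text \<open>On coordinates in \<open>?V\<close>, \<open>\<phi>\<close> is the quotient map modulo
  \<open>shifts \<Lambda>\<close>; it places the vertices around their barycentre at the origin. Its
  normalisation \<open>g\<close> is a continuous bijection from a compact space onto a unit sphere:
  \<open>realization_point_unique\<close> gives injectivity and \<open>nonneg_representative\<close>
  surjectivity.\<close>

lemma relations_imp_simplicial_sphere:
  assumes K: "abstract_simplicial_complex K" and real: "realized_by_relations K \<Lambda>"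
  shows "simplicial_sphere K"
proof -
  let ?V = "vertices K" and ?X = "realization_points K"
  note realD = realized_by_relationsD[OF real]
  have fV: "finite ?V" using K by (rule finite_vertices)
  note subM = function_subspace_shifts[OF realD(1)]
  obtain m and b :: "nat \<Rightarrow> 'a \<Rightarrow> real" where
    b: "\<And>x. (\<exists>y\<in>shifts \<Lambda>. \<forall>v\<in>?V. y v = x v) \<longleftrightarrow> (\<forall>j<m. (\<Sum>v\<in>?V. b j v * x v) = 0)"
    and surj: "\<And>u. \<exists>z. \<forall>j<m. (\<Sum>v\<in>?V. b j v * z v) = u j"
    by (rule function_subspace_equations[OF fV subM]) iprover
  define \<phi> where "\<phi> x j = (\<Sum>v\<in>?V. b j v * x v)" for x j
  define N where "N x = sqrt (\<Sum>j<m. (\<phi> x j)\<^sup>2)" for x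
  \<comment> \<open>The entries from \<open>m\<close> on are 0 because \<open>nsphere\<close>
    consists of sequences with zero tail.\<close>
  define g where "g x j = (if j < m then \<phi> x j / N x else 0)" for x j
  have unique: "r = 1 \<and> x = y"
    if x: "x \<in> ?X" and y: "y \<in> ?X" and r: "0 \<le> r" "r \<le> 1" and eq: "\<forall>j<m. \<phi> x j = r * \<phi> y j" for x y r
  proof (rule realization_point_unique[OF K real _ _ _ _ _ _ r])
    have "\<forall>j<m. (\<Sum>v\<in>?V. b j v * (x v - r * y v)) = 0"
      using eq by (simp add: \<phi>_def right_diff_distrib sum_subtractf mult.left_commute
          flip: sum_distrib_left)
    then show "\<exists>u\<in>shifts \<Lambda>. \<forall>v\<in>?V. u v = x v - r * y v" unfolding b .
  qed (use x y in \<open>auto simp: realization_points_def\<close>)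
  have Npos: "0 < N x" if x: "x \<in> ?X" for x
  proof (rule ccontr)
    assume "\<not> 0 < N x"
    moreover have "0 \<le> (\<Sum>j<m. (\<phi> x j)\<^sup>2)" by (intro sum_nonneg) simp
    ultimately have "(\<Sum>j<m. (\<phi> x j)\<^sup>2) = 0" by (simp add: N_def)
    then have "\<forall>j<m. \<phi> x j = 0 * \<phi> x j" by (simp add: sum_nonneg_eq_0_iff)
    then show False using unique[OF x x, of 0] by simp
  qed
  have "?V \<noteq> {}" using realD(3) K unfolding abstract_simplicial_complex_def by auto
  then obtain a where a: "a \<in> ?V" by blast
  then have "{a} \<in> K" using K unfolding abstract_simplicial_complex_def vertices_def by blast
  then have "(\<lambda>v. if v = a then 1 else 0) \<in> ?X"
    using fV a by (simp add: realization_points_def)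
  \<comment> \<open>Some realization point exists and its image has positive norm, so there is at
    least one equation; the sphere has dimension \<open>m - 1\<close>.\<close>
  from Npos[OF this] have "0 < m" by (cases m) (simp_all add: N_def)
  then obtain n where n: "m = Suc n" using gr0_implies_Suc by blast
  define T where "T = {t :: nat \<Rightarrow> real. (\<Sum>i\<le>n. t i ^ 2) = 1 \<and> (\<forall>i>n. t i = 0)}"
  have Nsq: "(N x)\<^sup>2 = (\<Sum>j<m. (\<phi> x j)\<^sup>2)" for x
    unfolding N_def by (intro real_sqrt_pow2 sum_nonneg) simp
  have "g x \<in> T" if x: "x \<in> ?X" for x
  proof -
    have "(\<Sum>j<m. (g x j)\<^sup>2) = (\<Sum>j<m. (\<phi> x j)\<^sup>2) / (N x)\<^sup>2"
      by (simp add: g_def power_divide sum_divide_distrib)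
    also have "\<dots> = 1" using Npos[OF x] unfolding Nsq[of x, symmetric] by simp
    finally show ?thesis by (simp add: T_def g_def n lessThan_Suc_atMost)
  qed
  moreover have "\<exists>x\<in>?X. g x = t" if t: "t \<in> T" for t
  proof -
    \<comment> \<open>A linear preimage of \<open>t\<close> is moved within its class to a
      nonnegative one supported on a face. Rescaling that to sum 1 divides its image by
      \<open>s\<close>, which the normalisation undoes.\<close>
    obtain z where z: "\<forall>j<m. (\<Sum>v\<in>?V. b j v * z v) = t j" using surj by blast
    obtain x y where x: "\<And>v. 0 \<le> x v" "{v. x v \<noteq> 0} \<in> K"
      and y: "y \<in> shifts \<Lambda>" "\<forall>v\<in>?V. x v = z v + y v"
      by (rule nonneg_representative[OF K real, of z]) blast
    have "\<forall>j<m. (\<Sum>v\<in>?V. b j v * y v) = 0" using b[of y] y(1) by blast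
    moreover have "\<phi> x j = (\<Sum>v\<in>?V. b j v * z v) + (\<Sum>v\<in>?V. b j v * y v)" for j
      using y(2) by (simp add: \<phi>_def distrib_left sum.distrib)
    ultimately have \<phi>x: "\<phi> x j = t j" if "j < m" for j using z that by simp
    have tsum: "(\<Sum>j<m. (t j)\<^sup>2) = 1" using t by (simp add: T_def n lessThan_Suc_atMost)
    define s where "s = sum x ?V"
    have "s \<noteq> 0"
    proof
      assume "s = 0"
      then have "\<forall>v\<in>?V. x v = 0" using x(1) fV by (simp add: s_def sum_nonneg_eq_0_iff)
      then have "\<forall>j<m. t j = 0" using \<phi>x by (simp add: \<phi>_def)
      then show False using tsum by simp
    qed
    moreover have "0 \<le> s" unfolding s_def using x(1) by (simp add: sum_nonneg)
    ultimately have s: "0 < s" by simp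
    define x' where "x' v = x v / s" for v
    have "x' \<in> ?X"
      using x s by (simp add: realization_points_def x'_def s_def flip: sum_divide_distrib)
    moreover have \<phi>x': "\<phi> x' j = t j / s" if "j < m" for j
      using \<phi>x[OF that] by (simp add: \<phi>_def x'_def flip: sum_divide_distrib)
    have "(\<Sum>j<m. (\<phi> x' j)\<^sup>2) = 1 / s\<^sup>2"
      using \<phi>x' tsum by (simp add: power_divide flip: sum_divide_distrib)
    then have "N x' = 1 / s" using s by (simp add: N_def real_sqrt_divide)
    then have "g x' = t"
      using \<phi>x' s t by (auto simp: fun_eq_iff g_def T_def n)
    ultimately show ?thesis by blast
  qed
  ultimately have "g ` ?X = T" by blast
  moreover have "inj_on g ?X"
  proof (rule inj_onI)
    \<comment> \<open>Ordering the two points by norm puts the ratio of the norms into the range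
      that \<open>unique\<close> requires.\<close>
    have wlog: "x = y" if xy: "x \<in> ?X" "y \<in> ?X" "g x = g y" "N x \<le> N y" for x y
    proof -
      have "\<phi> x j = N x / N y * \<phi> y j" if "j < m" for j
        using fun_cong[OF xy(3), of j] that Npos[OF xy(1)] Npos[OF xy(2)]
        by (simp add: g_def field_simps)
      moreover have "0 \<le> N x / N y" "N x / N y \<le> 1"
        using Npos[OF xy(1)] Npos[OF xy(2)] xy(4) by simp_all
      ultimately show ?thesis using unique[OF xy(1,2)] by blast
    qed
    show "x = y" if "x \<in> ?X" "y \<in> ?X" "g x = g y" for x y
      using wlog[of x y] wlog[of y x] that by (metis linear)
  qed
  moreover have "continuous_on ?X g"
  proof (rule continuous_on_coordinatewise_then_product)
    fix j
    have \<phi>: "continuous_on ?X (\<lambda>x. \<phi> x i)" for i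
      unfolding \<phi>_def by (rule continuous_on_weighted_sum)
    have "continuous_on ?X N"
      unfolding N_def by (intro continuous_intros \<phi>)
    then show "continuous_on ?X (\<lambda>x. g x j)"
      unfolding g_def using less_imp_neq[OF Npos, symmetric]
      by (cases "j < m") (auto intro!: continuous_on_divide \<phi>)
  qed
  ultimately have "top_of_set ?X homeomorphic_space top_of_set T"
    by (intro compact_homeomorphic_space compact_realization_points K)
  then have "geometric_realization K homeomorphic_space nsphere n"
    unfolding geometric_realization_eq[OF K] nsphere euclidean_product_topology T_def .
  then show ?thesis using K unfolding simplicial_sphere_def by blast
qed

section \<open>The criterion for polytopal spheres, the degenerate sphere, and the
  equivalence\<close>

lemma polytopal_sphere_iff_relations:
  assumes "abstract_simplicial_complex K" "K \<noteq> {{}}"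
  shows "polytopal_sphere K \<longleftrightarrow> (\<exists>\<Lambda>. realized_by_relations K \<Lambda>)"
  using assms polytopal_imp_relations relations_imp_polytopal relations_imp_simplicial_sphere
  unfolding polytopal_sphere_def by metis

text \<open>The sphere of dimension -1 is the boundary of a point, whose only proper face is empty.
  It needs a direct argument because no space of relations realizes it.\<close>

lemma polytopal_sphere_empty: "polytopal_sphere {{}}"
proof -
  let ?P = "{0 :: nat \<Rightarrow>\<^sub>0 real}"
  have proper: "F face_of ?P \<and> F \<noteq> ?P \<longleftrightarrow> F = {}" for F
    by (auto dest: face_of_imp_subset)
  have "polytope ?P" unfolding polytope_def by (intro exI[of _ ?P]) simp
  then have "simplicial_polytope ?P"
    unfolding simplicial_polytope_def proper by (auto intro: exI[of _ "{}"])
  moreover have "boundary_complex ?P = {{}}"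
    unfolding boundary_complex_def proper by simp
  then have "simplicial_iso {{} :: 'a set} (boundary_complex ?P)"
    by (simp add: simplicial_iso_def vertices_def bij_betw_def)
  moreover have "simplicial_sphere {{} :: 'a set}"
    by (simp add: simplicial_sphere_def abstract_simplicial_complex_def)
  ultimately show ?thesis unfolding polytopal_sphere_def by blast
qed

lemma vertices_empty_imp:
  assumes "abstract_simplicial_complex K" "vertices K = {}"
  shows "K = {{}}"
  using assms by (auto simp: abstract_simplicial_complex_def vertices_def)

theorem corollary5p2:
  fixes S :: "'a set set" and d :: nat
  assumes "simplicial_sphere S"
  shows "polytopal_sphere (wreath d S) \<longleftrightarrow> polytopal_sphere S"
proof -
  have S: "abstract_simplicial_complex S" using assms by (simp add: simplicial_sphere_def)
  note W = abstract_simplicial_complex_wreath[OF S, of d]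
  show ?thesis
  proof (cases "S = {{}}")
    case True
    then have "wreath d S = {{}}"
      using vertices_wreath[OF S] vertices_empty_imp[OF W] by (simp add: vertices_def)
    then show ?thesis using True polytopal_sphere_empty by metis
  next
    case False
    then have "vertices S \<noteq> {}" using vertices_empty_imp[OF S] by blast
    then have "vertices (wreath d S) \<noteq> {}" unfolding vertices_wreath[OF S] by simp
    then have "wreath d S \<noteq> {{}}" by (auto simp: vertices_def)
    then show ?thesis
      using polytopal_sphere_iff_relations[OF S False] polytopal_sphere_iff_relations[OF W]
        relations_wreath[OF S] relations_of_wreath[OF S] by metis
  qed
qed

end
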